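(* (i) For every integer $s\ge 2$, there are exactly $7$ binary optimal LCD $[7s+1,3]$ codes with dual distances $d^\perp\ge 2$, up to equivalence. (ii) Suppose that $t\in\{4,6\}$. Then for every integer $s\ge 1$, there are exactly $5$ binary optimal LCD $[7s+t,3]$ codes with dual distances $d^\perp\ge 2$, up to equivalence.
   Context: A binary $[n,k]$ code is a $k$-dimensional subspace $C$ of $\mathbb{F}_2^n$; an $[n,k,d]$ code is one whose minimum weight (the smallest Hamming weight of a nonzero codeword) is exactly $d$. The dual code is $C^\perp=\{x\in\mathbb{F}_2^n: x\cdot y=0 \text{ for all } y\in C\}$ for the standard inner product. $C$ is LCD (linear complementary dual) if $C\cap C^\perp=\{0\}$. The dual distance $d^\perp$ of $C$ is the minimum weight of $C^\perp$. Two binary $[n,k]$ codes are equivalent if one is obtained from the other by a permutation of coordinates. Let $d_2(n,k)$ be the largest $d$ such that a binary LCD $[n,k,d]$ code exists; an LCD $[n,k,d_2(n,k)]$ code is called optimal. (It is known that $d_2(7s+1,3)=4s-1$, $d_2(7s+4,3)=4s+1$ and $d_2(7s+6,3)=4s+2$ for the lengths considered.) *)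

theory Defs
  imports
    "HOL-Library.Z2"
    "HOL-Combinatorics.Permutations"
    "Jordan_Normal_Form.VS_Connect"
begin

text \<open>
  The ambient space is the vector space of all \<^typ>\<open>bit vec\<close> of dimension \<open>n\<close>.  The dimension
  of a code is that of the code itself, viewed as a vector space with the restricted carrier.
\<close>

definition binary_code :: "nat \<Rightarrow> nat \<Rightarrow> bit vec set \<Rightarrow> bool" where
  "binary_code n k C \<longleftrightarrow>
     VectorSpace.subspace class_ring C (module_vec TYPE(bit) n) \<and>
     vectorspace.dim class_ring (module_vec TYPE(bit) n \<lparr>carrier := C\<rparr>) = k"

definition hamming_weight :: "bit vec \<Rightarrow> nat" where
  "hamming_weight x = card {i. i < dim_vec x \<and> x $ i \<noteq> 0}"

text \<open>Unspecified if \<open>C\<close> has no nonzero codeword.\<close>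

definition min_weight :: "nat \<Rightarrow> bit vec set \<Rightarrow> nat" where
  "min_weight n C = Min (hamming_weight ` (C - {0\<^sub>v n}))"

definition binary_code_dist :: "nat \<Rightarrow> nat \<Rightarrow> nat \<Rightarrow> bit vec set \<Rightarrow> bool" where
  "binary_code_dist n k d C \<longleftrightarrow>
     binary_code n k C \<and> C \<noteq> {0\<^sub>v n} \<and> min_weight n C = d"

definition dual_code :: "nat \<Rightarrow> bit vec set \<Rightarrow> bit vec set" where
  "dual_code n C = {x \<in> carrier_vec n. \<forall>y\<in>C. x \<bullet> y = 0}"

definition LCD :: "nat \<Rightarrow> bit vec set \<Rightarrow> bool" where
  "LCD n C \<longleftrightarrow> C \<inter> dual_code n C = {0\<^sub>v n}"

text \<open>Meaningful whenever the dual is nonzero, i.e. for codes of dimension less than \<open>n\<close>.\<close>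

definition dual_distance :: "nat \<Rightarrow> bit vec set \<Rightarrow> nat" where
  "dual_distance n C = min_weight n (dual_code n C)"

definition d2 :: "nat \<Rightarrow> nat \<Rightarrow> nat" where
  "d2 n k = Max {d. \<exists>C. binary_code_dist n k d C \<and> LCD n C}"

definition optimal_LCD :: "nat \<Rightarrow> nat \<Rightarrow> bit vec set \<Rightarrow> bool" where
  "optimal_LCD n k C \<longleftrightarrow> LCD n C \<and> binary_code_dist n k (d2 n k) C"

definition permute_coords :: "(nat \<Rightarrow> nat) \<Rightarrow> bit vec \<Rightarrow> bit vec" where
  "permute_coords p x = vec (dim_vec x) (\<lambda>i. x $ p i)"

definition code_equiv :: "nat \<Rightarrow> nat \<Rightarrow> (bit vec set \<times> bit vec set) set" where
  "code_equiv n k =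
     {(C, D). binary_code n k C \<and> binary_code n k D \<and>
              (\<exists>p. p permutes {..<n} \<and> D = permute_coords p ` C)}"

lemma binary_code_carrier:
  assumes "binary_code n k C"
  shows "C \<subseteq> carrier_vec n"
proof -
  have "submodule class_ring C (module_vec TYPE(bit) n)"
    using assms unfolding binary_code_def VectorSpace.subspace_def by (elim conjE)
  from submodule.subset[OF this] show ?thesis
    by (simp only: module_vec_simps)
qed

lemma permute_coords_comp:
  assumes "q permutes {..<n}" "x \<in> carrier_vec n"
  shows "permute_coords q (permute_coords p x) = permute_coords (p \<circ> q) x"
proof (rule eq_vecI)
  fix i assume "i < dim_vec (permute_coords (p \<circ> q) x)"
  then have "i < n" "dim_vec x = n"
    using assms(2) by (simp_all add: permute_coords_def)
  moreover from this have "q i < n"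
    using permutes_in_image[OF assms(1), of i] by simp
  ultimately show "permute_coords q (permute_coords p x) $ i = permute_coords (p \<circ> q) x $ i"
    by (simp add: permute_coords_def)
qed (simp add: permute_coords_def)

lemma permute_coords_id: "permute_coords id x = x"
  by (rule eq_vecI) (simp_all add: permute_coords_def)

lemma equiv_code_equiv: "equiv {C. binary_code n k C} (code_equiv n k)"
proof (rule equivI)
  show "code_equiv n k \<subseteq> {C. binary_code n k C} \<times> {C. binary_code n k C}"
    by (auto simp: code_equiv_def)
  show "refl_on {C. binary_code n k C} (code_equiv n k)"
  proof (rule refl_onI)
    fix C assume "C \<in> {C. binary_code n k C}"
    moreover have "permute_coords id ` C = C"
      by (simp add: permute_coords_id)
    ultimately show "(C, C) \<in> code_equiv n k"
      unfolding code_equiv_def using permutes_id by (simp, metis)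
  qed
  show "sym (code_equiv n k)"
  proof (rule symI)
    fix C D assume "(C, D) \<in> code_equiv n k"
    then obtain p where C: "binary_code n k C" "binary_code n k D"
      and p: "p permutes {..<n}" "D = permute_coords p ` C"
      by (auto simp: code_equiv_def)
    have "permute_coords (inv_into UNIV p) ` D = C"
    proof -
      have "permute_coords (inv_into UNIV p) (permute_coords p x) = x" if "x \<in> C" for x
        using permute_coords_comp[OF permutes_inv[OF p(1)], of x p] that
          binary_code_carrier[OF C(1)]
        by (simp only: permutes_inv_o(1)[OF p(1)] permute_coords_id) blast
      then have "(\<lambda>x. permute_coords (inv_into UNIV p) (permute_coords p x)) ` C = (\<lambda>x. x) ` C"
        by (rule image_cong[OF refl])
      then show ?thesis unfolding p(2) image_image by simp
    qed
    then show "(D, C) \<in> code_equiv n k"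
      using C permutes_inv[OF p(1)] by (auto simp: code_equiv_def intro!: exI[of _ "inv_into UNIV p"])
  qed
  show "trans (code_equiv n k)"
  proof (rule transI)
    fix C D E assume "(C, D) \<in> code_equiv n k" "(D, E) \<in> code_equiv n k"
    then obtain p q where C: "binary_code n k C" "binary_code n k E"
      and p: "p permutes {..<n}" "D = permute_coords p ` C"
      and q: "q permutes {..<n}" "E = permute_coords q ` D"
      by (auto simp: code_equiv_def)
    have "E = permute_coords (p \<circ> q) ` C"
      unfolding q(2) p(2) image_image using permute_coords_comp[OF q(1)]
        binary_code_carrier[OF C(1)] by (intro image_cong) auto
    then show "(C, E) \<in> code_equiv n k"
      using C permutes_compose[OF q(1) p(1)] by (auto simp: code_equiv_def intro!: exI[of _ "p \<circ> q"])
  qed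
qed

end

theory Submission
  imports Defs
begin

text \<open>
  The inner product of two words is governed by weights: \<open>x \<bullet> y = 0\<close> if and only if the weight of
  \<open>x + y\<close> is congruent modulo 4 to the sum of the weights of \<open>x\<close> and \<open>y\<close>, and \<open>x \<bullet> x\<close> is the parity
  of the weight. An LCD code of dimension three carries a nondegenerate symmetric form that is not
  alternating, since alternating forms in odd dimension degenerate. Hence it has an orthonormal
  basis \<open>a\<close>, \<open>b\<close>, \<open>c\<close> (\<open>LCD_imp_orthonormal\<close>). This basis is unique up to order
  (\<open>profile_unique\<close>), because the only other word of odd weight is \<open>a + b + c\<close>, which is not
  orthogonal to the basis vectors.

  Together with the length, the weights of the seven nonzero words determine the multiplicities of the columns of the generator matrix
  (\<open>count_columns\<close>), hence the code up to permutation of coordinates. So the weights, taken up to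
  the action of the symmetric group on the basis, are a complete invariant of the code
  (\<open>code_equiv_iff_profile\<close>). Conversely, seven numbers are weights of an LCD code with respect to an
  orthonormal basis as soon as the first three are odd, the others are congruent modulo 4 to the
  corresponding sums of the first three, and the column multiplicities computed from them are
  nonnegative (\<open>exists_orthonormal_basis_with_weights\<close>).

  Dual distance at least 2 means that no column vanishes, equivalently that the seven weights have
  sum \<open>4 n\<close>. If the minimum weight is \<open>d\<close>, the excesses of the weights over \<open>d\<close> are natural numbers
  with sum \<open>4 n - 7 d\<close>, at least one of them zero, subject to congruences that depend only on
  \<open>d mod 4\<close>. For the lengths \<open>7 s + 1\<close>, \<open>7 s + 4\<close>, \<open>7 s + 6\<close> with \<open>d = 4 s - 1\<close>, \<open>4 s + 1\<close>, \<open>4 s + 2\<close>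
  the sum is 11, 9, 10 and the residue is 3, 1, 2, independently of \<open>s\<close>. What remains is one finite
  search for each family. The same search with \<open>d + 1\<close> in place of \<open>d\<close> finds nothing, even if
  vanishing columns, which lower the sum, are allowed; this shows that
  \<open>d\<close> is the optimal minimum weight.
\<close>

section \<open>Binary codes as additive sets of vectors\<close>

lemma finite_binary_vectors: "finite (carrier_vec n :: bit vec set)"
proof -
  have "carrier_vec n \<subseteq> vec_of_list ` {xs :: bit list. set xs \<subseteq> {0, 1} \<and> length xs = n}"
  proof
    fix x :: "bit vec" assume "x \<in> carrier_vec n"
    then have "x = vec_of_list (list_of_vec x)" "length (list_of_vec x) = n"
      by (auto simp: vec_list)
    moreover have "set (list_of_vec x) \<subseteq> {0, 1}"
      using bit.exhaust by auto
    ultimately show "x \<in> vec_of_list ` {xs. set xs \<subseteq> {0, 1} \<and> length xs = n}"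
      by blast
  qed
  moreover have "finite {xs :: bit list. set xs \<subseteq> {0, 1} \<and> length xs = n}"
    by (rule finite_lists_length_eq) simp
  ultimately show ?thesis by (meson finite_imageI finite_subset)
qed

text \<open>
  Every vector has unique coordinates with respect to a finite basis, so the coordinate functions
  on the basis count the space.
\<close>

lemma (in vectorspace) card_carrier_eq_power_dim:
  assumes "fin_dim"
  shows "card (carrier V) = card (carrier K) ^ dim"
proof -
  obtain B where B: "finite B" "basis B"
    using finite_basis_exists[OF assms] by blast
  then have sub: "B \<subseteq> carrier V" by (simp add: basis_def)
  have unique: "\<exists>!a. a \<in> B \<rightarrow>\<^sub>E carrier K \<and> lincomb a B = v" if "v \<in> carrier V" for v
    using basis_criterion[OF B(1) sub] B(2) that by blast
  have closed: "lincomb a B \<in> carrier V" if "a \<in> B \<rightarrow>\<^sub>E carrier K" for a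
    using that sub by (intro lincomb_closed) auto
  have "bij_betw (\<lambda>a. lincomb a B) (B \<rightarrow>\<^sub>E carrier K) (carrier V)"
  proof (rule bij_betwI')
    show "lincomb a B = lincomb a' B \<longleftrightarrow> a = a'"
      if "a \<in> B \<rightarrow>\<^sub>E carrier K" "a' \<in> B \<rightarrow>\<^sub>E carrier K" for a a'
      using unique[OF closed[OF that(1)]] that by metis
  next
    show "lincomb a B \<in> carrier V" if "a \<in> B \<rightarrow>\<^sub>E carrier K" for a
      using closed that .
  next
    show "\<exists>a\<in>B \<rightarrow>\<^sub>E carrier K. v = lincomb a B" if "v \<in> carrier V" for v
      using unique[OF that] by blast
  qed
  then have "card (carrier V) = card (B \<rightarrow>\<^sub>E carrier K)"
    by (simp add: bij_betw_same_card)
  also have "\<dots> = card (carrier K) ^ card B"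
    by (simp add: card_funcsetE B(1))
  finally show ?thesis by (simp add: dim_basis[OF B])
qed

text \<open>
  The subspaces of the binary vector space of length \<open>n\<close>.
\<close>

definition additive :: "nat \<Rightarrow> bit vec set \<Rightarrow> bool" where
  "additive n S \<longleftrightarrow> S \<subseteq> carrier_vec n \<and> 0\<^sub>v n \<in> S \<and> (\<forall>x\<in>S. \<forall>y\<in>S. x + y \<in> S)"

text \<open>
  Over the two-element field closure under scalars is automatic, and the dimension can be read off
  from the cardinality. All later arguments use this description.
\<close>

lemma binary_code_iff:
  "binary_code n k C \<longleftrightarrow> additive n C \<and> card C = 2 ^ k"
proof -
  let ?V = "module_vec TYPE(bit) n"
  interpret vec_space "TYPE(bit)" n .
  have subspace: "VectorSpace.subspace class_ring C ?V \<longleftrightarrow>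
      C \<subseteq> carrier_vec n \<and> 0\<^sub>v n \<in> C \<and> (\<forall>x\<in>C. \<forall>y\<in>C. x + y \<in> C)" (is "_ \<longleftrightarrow> ?closed")
  proof
    assume "VectorSpace.subspace class_ring C ?V"
    then have "submodule class_ring C ?V" by (rule subspace.submod)
    then show ?closed
      using submodule.subset submodule.m_closed submodule.zero_closed
      by (metis module_vec_simps)
  next
    assume closed: ?closed
    have "x \<cdot>\<^sub>v v \<in> C" if "v \<in> C" for x :: bit and v
    proof (cases "x = 0")
      case True
      then have "x \<cdot>\<^sub>v v = 0\<^sub>v n"
        using that closed by (intro eq_vecI) auto
      then show ?thesis using closed by simp
    next
      case False
      then show ?thesis using that by simp
    qed
    then have "submodule class_ring C ?V"
      using closed by (intro submodule.intro module_axioms) (auto simp: module_vec_simps)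
    then show "VectorSpace.subspace class_ring C ?V"
      by (intro subspace.intro vectorspace_axioms)
  qed
  have dim: "card C = 2 ^ vectorspace.dim class_ring (?V \<lparr>carrier := C\<rparr>)"
    if "VectorSpace.subspace class_ring C ?V"
  proof -
    let ?W = "?V \<lparr>carrier := C\<rparr>"
    interpret W: vectorspace class_ring ?W
      using subspace_is_vs[OF that] .
    have fin: "finite C"
      using that subspace finite_subset[OF _ finite_binary_vectors] by blast
    have "W.fin_dim"
      unfolding W.fin_dim_def
    proof (intro exI[of _ C] conjI fin)
      show "C \<subseteq> carrier ?W" by simp
      have "C \<subseteq> W.span C" by (rule W.in_own_span) simp
      moreover have "W.span C \<subseteq> carrier ?W" by (rule W.span_is_subset2) simp
      ultimately show "W.gen_set C" by simp
    qed
    then have "card (carrier ?W) = card (carrier (class_ring :: bit ring)) ^ W.dim"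
      by (rule W.card_carrier_eq_power_dim)
    moreover have "card (UNIV :: bit set) = 2"
    proof -
      have "(UNIV :: bit set) = {0, 1}" using bit.exhaust by blast
      then have "card (UNIV :: bit set) = card {0, 1 :: bit}" by (rule arg_cong)
      then show ?thesis by simp
    qed
    ultimately show ?thesis by simp
  qed
  show ?thesis
    unfolding binary_code_def additive_def using subspace dim by auto
qed

section \<open>Hamming weights and the inner product\<close>

lemma add_self_bit_vec [simp]: "x + x = 0\<^sub>v (dim_vec x)" for x :: "bit vec"
  by (rule eq_vecI) auto

text \<open>
  Stated with exclusive or of the supports, the form in which coordinatewise weight counts are
  decided.
\<close>

lemma add_nonzero_bit: "x + y \<noteq> 0 \<longleftrightarrow> (x \<noteq> 0) \<noteq> (y \<noteq> 0)" for x y :: bit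
  by (cases "x = 0"; cases "y = 0") auto

lemma of_nat_bit_eq_zero_iff: "(of_nat m :: bit) = 0 \<longleftrightarrow> even m"
proof -
  have "b = 0 \<longleftrightarrow> even b" for b :: bit
    by (cases "b = 0") simp_all
  then show ?thesis by (simp only: even_of_nat)
qed

definition overlap :: "bit vec \<Rightarrow> bit vec \<Rightarrow> nat" where
  "overlap x y = card {i. i < dim_vec x \<and> x $ i \<noteq> 0 \<and> y $ i \<noteq> 0}"

lemma scalar_prod_eq_overlap:
  assumes "x \<in> carrier_vec n" "y \<in> carrier_vec n"
  shows "x \<bullet> y = of_nat (overlap x y)"
proof -
  have "x \<bullet> y = (\<Sum>i<n. x $ i * y $ i)"
    using assms by (auto simp: scalar_prod_def atLeast0LessThan)
  also have "\<dots> = (\<Sum>i<n. of_bool (x $ i \<noteq> 0 \<and> y $ i \<noteq> 0))"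
    by (intro sum.cong refl) auto
  also have "\<dots> = of_nat (card ({i. x $ i \<noteq> 0 \<and> y $ i \<noteq> 0} \<inter> {..<n}))"
    by (simp only: sum_of_bool_eq finite_lessThan Int_commute)
  also have "{i. x $ i \<noteq> 0 \<and> y $ i \<noteq> 0} \<inter> {..<n} = {i. i < dim_vec x \<and> x $ i \<noteq> 0 \<and> y $ i \<noteq> 0}"
    using assms by auto
  finally show ?thesis by (simp only: overlap_def)
qed

lemma hamming_weight_eq_sum:
  assumes "x \<in> carrier_vec n"
  shows "hamming_weight x = (\<Sum>i<n. of_bool (x $ i \<noteq> 0))"
proof -
  have "(\<Sum>i<n. of_bool (x $ i \<noteq> 0)) = card ({i. x $ i \<noteq> 0} \<inter> {..<n})"
    by (simp only: sum_of_bool_eq finite_lessThan Int_commute of_nat_id)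
  also have "{i. x $ i \<noteq> 0} \<inter> {..<n} = {i. i < dim_vec x \<and> x $ i \<noteq> 0}"
    using assms by auto
  finally show ?thesis by (simp only: hamming_weight_def)
qed

lemma overlap_eq_sum:
  assumes "x \<in> carrier_vec n"
  shows "overlap x y = (\<Sum>i<n. of_bool (x $ i \<noteq> 0 \<and> y $ i \<noteq> 0))"
proof -
  have "(\<Sum>i<n. of_bool (x $ i \<noteq> 0 \<and> y $ i \<noteq> 0)) =
      card ({i. x $ i \<noteq> 0 \<and> y $ i \<noteq> 0} \<inter> {..<n})"
    by (simp only: sum_of_bool_eq finite_lessThan Int_commute of_nat_id)
  also have "{i. x $ i \<noteq> 0 \<and> y $ i \<noteq> 0} \<inter> {..<n} =
      {i. i < dim_vec x \<and> x $ i \<noteq> 0 \<and> y $ i \<noteq> 0}"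
    using assms by auto
  finally show ?thesis by (simp only: overlap_def)
qed

lemma hamming_weight_add:
  assumes "x \<in> carrier_vec n" "y \<in> carrier_vec n"
  shows "hamming_weight (x + y) + 2 * overlap x y = hamming_weight x + hamming_weight y"
proof -
  let ?s = "\<lambda>x i. x $ i \<noteq> (0 :: bit)"
  have sum: "x + y \<in> carrier_vec n" using assms by simp
  have "of_bool (?s (x + y) i) + 2 * of_bool (?s x i \<and> ?s y i) =
      (of_bool (?s x i) + of_bool (?s y i) :: nat)" if "i < n" for i
  proof -
    have "?s (x + y) i \<longleftrightarrow> ?s x i \<noteq> ?s y i"
      using that assms by (metis index_add_vec(1) carrier_vecD add_nonzero_bit)
    then show ?thesis by (cases "?s x i"; cases "?s y i") simp_all
  qed
  then have "(\<Sum>i<n. of_bool (?s (x + y) i) + 2 * of_bool (?s x i \<and> ?s y i)) =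
      (\<Sum>i<n. of_bool (?s x i) + of_bool (?s y i) :: nat)"
    by (intro sum.cong) blast+
  then show ?thesis
    by (simp only: hamming_weight_eq_sum[OF sum] hamming_weight_eq_sum[OF assms(1)]
      hamming_weight_eq_sum[OF assms(2)] overlap_eq_sum[OF assms(1)] sum_distrib_left sum.distrib)
qed

text \<open>
  Applied with \<open>p\<close> the size of the overlap of two supports: the weight of a sum is the sum of the
  weights minus twice the overlap.
\<close>

lemma even_iff_mod_4_eq:
  fixes h m p :: nat
  assumes "h + 2 * p = m"
  shows "even p \<longleftrightarrow> h mod 4 = m mod 4"
proof -
  have "h mod 4 = m mod 4 \<longleftrightarrow> 4 dvd 2 * p"
    using assms mod_eq_dvd_iff_nat[of h m 4] by auto
  then show ?thesis by (simp add: dvd_mult_cancel1 flip: mult_2)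
qed

text \<open>
  Inner products are determined by weights modulo 4. This turns the LCD property into congruences
  between the weights of codewords.
\<close>

lemma scalar_prod_eq_zero_iff:
  assumes "x \<in> carrier_vec n" "y \<in> carrier_vec n"
  shows "x \<bullet> y = 0 \<longleftrightarrow>
    hamming_weight (x + y) mod 4 = (hamming_weight x + hamming_weight y) mod 4"
proof -
  have "x \<bullet> y = 0 \<longleftrightarrow> even (overlap x y)"
    unfolding scalar_prod_eq_overlap[OF assms]
    by (rule of_nat_bit_eq_zero_iff)
  then show ?thesis
    using even_iff_mod_4_eq[OF hamming_weight_add[OF assms]] by simp
qed

lemma scalar_prod_self_eq_zero_iff:
  assumes "x \<in> carrier_vec n"
  shows "x \<bullet> x = 0 \<longleftrightarrow> even (hamming_weight x)"
proof -
  have "overlap x x = hamming_weight x"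
    by (simp add: overlap_def hamming_weight_def)
  then show ?thesis
    using scalar_prod_eq_overlap[OF assms assms] of_nat_bit_eq_zero_iff by metis
qed

section \<open>Spanning a three-dimensional code\<close>

text \<open>
  Adding one generator at a time doubles an additive set; the span of three vectors is obtained by
  three doublings.
\<close>

definition adjoin :: "bit vec \<Rightarrow> bit vec set \<Rightarrow> bit vec set" where
  "adjoin z S = S \<union> (\<lambda>s. s + z) ` S"

definition span3 :: "nat \<Rightarrow> bit vec \<Rightarrow> bit vec \<Rightarrow> bit vec \<Rightarrow> bit vec set" where
  "span3 n a b c = adjoin c (adjoin b (adjoin a {0\<^sub>v n}))"

lemma span3_eq:
  assumes "a \<in> carrier_vec n" "b \<in> carrier_vec n" "c \<in> carrier_vec n"
  shows "span3 n a b c = {0\<^sub>v n, a, b, c, b + c, a + c, a + b, a + b + c}"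
  using assms by (auto simp: span3_def adjoin_def)

lemma add_cancel_left_bit_vec:
  fixes x :: "bit vec"
  assumes "x \<in> carrier_vec n" "z \<in> carrier_vec n"
  shows "z + (z + x) = x"
proof -
  have "z + (z + x) = (z + z) + x"
    using assms by (intro assoc_add_vec[symmetric])
  also have "z + z = 0\<^sub>v n" using assms by auto
  also have "0\<^sub>v n + x = x" using assms by simp
  finally show ?thesis .
qed

lemma additive_adjoin:
  assumes S: "additive n S" and z: "z \<in> carrier_vec n"
  shows "additive n (adjoin z S)"
proof -
  have sub: "S \<subseteq> carrier_vec n" and closed: "\<And>x y. x \<in> S \<Longrightarrow> y \<in> S \<Longrightarrow> x + y \<in> S"
    using S by (auto simp: additive_def)
  have sums: "(x + z) + y = (x + y) + z" "x + (y + z) = (x + y) + z" "(x + z) + (y + z) = x + y"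
    if "x \<in> S" "y \<in> S" for x y
  proof -
    have c: "x \<in> carrier_vec n" "y \<in> carrier_vec n" using that sub by auto
    have yz: "y + z = z + y" using c z by (intro comm_add_vec)
    show "x + (y + z) = (x + y) + z" using c z by simp
    then show "(x + z) + y = (x + y) + z" using c z by (simp add: yz)
    have "(x + z) + (y + z) = x + (z + (z + y))" using c z by (simp add: yz)
    then show "(x + z) + (y + z) = x + y" using add_cancel_left_bit_vec[OF c(2) z] by simp
  qed
  have "x + y \<in> adjoin z S" if xy: "x \<in> adjoin z S" "y \<in> adjoin z S" for x y
  proof -
    obtain s t where st: "s \<in> S" "t \<in> S" "x \<in> {s, s + z}" "y \<in> {t, t + z}"
      using xy by (auto simp: adjoin_def)
    then have "x + y \<in> {s + t, s + t + z}"
      using sums[OF st(1,2)] by auto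
    then show ?thesis
      using closed[OF st(1,2)] by (auto simp: adjoin_def)
  qed
  then show ?thesis
    using S z unfolding additive_def by (auto simp: adjoin_def)
qed

lemma card_adjoin:
  assumes S: "additive n S" and z: "z \<in> carrier_vec n" "z \<notin> S"
  shows "card (adjoin z S) = 2 * card S"
proof -
  have sub: "S \<subseteq> carrier_vec n" and closed: "\<And>x y. x \<in> S \<Longrightarrow> y \<in> S \<Longrightarrow> x + y \<in> S"
    using S by (auto simp: additive_def)
  have fin: "finite S"
    using sub finite_binary_vectors finite_subset by blast
  have cancel: "z + (s + z) = s" if "s \<in> S" for s
  proof -
    have s: "s \<in> carrier_vec n" using that sub by blast
    then have "s + z = z + s" using z(1) by (intro comm_add_vec)
    then show ?thesis using add_cancel_left_bit_vec[OF s z(1)] by simp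
  qed
  then have "inj_on (\<lambda>s. s + z) S"
    by (rule inj_on_inverseI)
  moreover have "S \<inter> (\<lambda>s. s + z) ` S = {}"
  proof -
    have "s + z \<notin> S" if s: "s \<in> S" for s
    proof
      assume "s + z \<in> S"
      then have "s + (s + z) \<in> S" using s closed by blast
      moreover have "s + (s + z) = z"
        using s sub z(1) by (intro add_cancel_left_bit_vec) auto
      ultimately show False using z(2) by simp
    qed
    then show ?thesis by blast
  qed
  ultimately show ?thesis
    using fin by (simp add: adjoin_def card_Un_disjoint card_image)
qed

lemma additive_span3:
  assumes "a \<in> carrier_vec n" "b \<in> carrier_vec n" "c \<in> carrier_vec n"
  shows "additive n (span3 n a b c)"
  unfolding span3_def using assms
  by (intro additive_adjoin) (auto simp: additive_def)

lemma card_span3: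
  assumes carr: "a \<in> carrier_vec n" "b \<in> carrier_vec n" "c \<in> carrier_vec n"
    and indep: "a \<noteq> 0\<^sub>v n" "b \<notin> {0\<^sub>v n, a}" "c \<notin> {0\<^sub>v n, a, b, a + b}"
  shows "card (span3 n a b c) = 8"
proof -
  have 0: "additive n {0\<^sub>v n}" by (simp add: additive_def)
  have 1: "additive n (adjoin a {0\<^sub>v n})"
    by (rule additive_adjoin[OF 0 carr(1)])
  have 2: "additive n (adjoin b (adjoin a {0\<^sub>v n}))"
    by (rule additive_adjoin[OF 1 carr(2)])
  have "card (adjoin a {0\<^sub>v n}) = 2"
    using card_adjoin[OF 0 carr(1)] indep by simp
  moreover have "b \<notin> adjoin a {0\<^sub>v n}"
    using indep carr by (auto simp: adjoin_def)
  moreover have "c \<notin> adjoin b (adjoin a {0\<^sub>v n})"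
    using indep carr by (auto simp: adjoin_def)
  ultimately show ?thesis
    unfolding span3_def by (simp add: card_adjoin[OF 2 carr(3)] card_adjoin[OF 1 carr(2)])
qed

lemma binary_code_3_iff: "binary_code n 3 C \<longleftrightarrow> additive n C \<and> card C = 8"
  by (simp add: binary_code_iff)

lemma span3_subset:
  assumes C: "additive n C" and abc: "a \<in> C" "b \<in> C" "c \<in> C"
  shows "span3 n a b c \<subseteq> C"
proof -
  have "adjoin z S \<subseteq> C" if "z \<in> C" "S \<subseteq> C" for z S
    using that C by (auto simp: adjoin_def additive_def)
  then show ?thesis
    unfolding span3_def using C abc by (simp add: additive_def)
qed

text \<open>
  Three codewords, each outside the span of the previous ones, span eight words, hence the whole code.
\<close>

lemma eq_span3:
  assumes C: "additive n C" "card C = 8" and abc: "a \<in> C" "b \<in> C" "c \<in> C"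
    and indep: "a \<noteq> 0\<^sub>v n" "b \<notin> {0\<^sub>v n, a}" "c \<notin> {0\<^sub>v n, a, b, a + b}"
  shows "C = span3 n a b c"
proof -
  have "a \<in> carrier_vec n" "b \<in> carrier_vec n" "c \<in> carrier_vec n"
    using C abc by (auto simp: additive_def)
  then have "card (span3 n a b c) = card C"
    using card_span3 indep C(2) by metis
  moreover have "finite C" using C(2) card.infinite by force
  ultimately show ?thesis
    using span3_subset[OF C(1) abc] card_subset_eq by metis
qed

text \<open>
  Used with the span of at most two codewords to find a further independent one.
\<close>

lemma exists_not_in_small_set:
  assumes "card C = 8"
  shows "\<exists>x\<in>C. x \<notin> {p, q, r, s}"
proof (rule ccontr)
  assume "\<not> ?thesis"
  then have "card C \<le> card {p, q, r, s}" by (intro card_mono) auto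
  also have "\<dots> \<le> 4" using card_length[of "[p, q, r, s]"] by simp
  finally show False using assms by simp
qed

section \<open>LCD codes of dimension three have orthonormal bases\<close>

text \<open>
  The inner product is not positive, but over the two-element field an orthonormal basis still
  exhibits nondegeneracy of the restricted form.
\<close>

definition orthonormal_basis ::
    "nat \<Rightarrow> bit vec set \<Rightarrow> bit vec \<Rightarrow> bit vec \<Rightarrow> bit vec \<Rightarrow> bool" where
  "orthonormal_basis n C a b c \<longleftrightarrow>
     a \<in> carrier_vec n \<and> b \<in> carrier_vec n \<and> c \<in> carrier_vec n \<and>
     a \<bullet> a = 1 \<and> b \<bullet> b = 1 \<and> c \<bullet> c = 1 \<and> a \<bullet> b = 0 \<and> a \<bullet> c = 0 \<and> b \<bullet> c = 0 \<and>
     C = span3 n a b c"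

lemma orthonormal_basisD:
  assumes "orthonormal_basis n C a b c"
  shows "a \<in> carrier_vec n" "b \<in> carrier_vec n" "c \<in> carrier_vec n"
    and "a \<bullet> a = 1" "b \<bullet> b = 1" "c \<bullet> c = 1"
    and "a \<bullet> b = 0" "a \<bullet> c = 0" "b \<bullet> c = 0" "b \<bullet> a = 0" "c \<bullet> a = 0" "c \<bullet> b = 0"
    and "C = {0\<^sub>v n, a, b, c, b + c, a + c, a + b, a + b + c}"
proof -
  show abc: "a \<in> carrier_vec n" "b \<in> carrier_vec n" "c \<in> carrier_vec n"
    and "a \<bullet> a = 1" "b \<bullet> b = 1" "c \<bullet> c = 1"
    and orth: "a \<bullet> b = 0" "a \<bullet> c = 0" "b \<bullet> c = 0"
    using assms unfolding orthonormal_basis_def by blast+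
  show "b \<bullet> a = 0" "c \<bullet> a = 0" "c \<bullet> b = 0"
    using orth comm_scalar_prod[OF abc(2,1)] comm_scalar_prod[OF abc(3,1)]
      comm_scalar_prod[OF abc(3,2)] by simp_all
  show "C = {0\<^sub>v n, a, b, c, b + c, a + c, a + b, a + b + c}"
    using assms span3_eq[OF abc] unfolding orthonormal_basis_def by blast
qed

text \<open>
  The coordinates of a word are its inner products with the basis. So a word orthogonal to the code
  is zero, and the basis vectors are independent.
\<close>

lemma orthonormal_imp_LCD:
  assumes onb: "orthonormal_basis n C a b c"
  shows "binary_code n 3 C" "LCD n C"
proof -
  note abc = orthonormal_basisD(1-3)[OF onb]
  note C = orthonormal_basisD(13)[OF onb]
  have C': "C = span3 n a b c" using onb by (simp add: orthonormal_basis_def)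
  note dots = add_scalar_prod_distrib[of _ n] scalar_prod_left_zero[of _ n]
    orthonormal_basisD(4-12)[OF onb] abc
  have "a \<noteq> 0\<^sub>v n" using dots(3) scalar_prod_left_zero[OF abc(1)] by auto
  moreover have "x \<bullet> b = 0" if "x \<in> {0\<^sub>v n, a}" for x
    using that by (auto simp: dots)
  then have "b \<notin> {0\<^sub>v n, a}" using dots(4) by force
  moreover have "x \<bullet> c = 0" if "x \<in> {0\<^sub>v n, a, b, a + b}" for x
    using that by (auto simp: dots)
  then have "c \<notin> {0\<^sub>v n, a, b, a + b}" using dots(5) by force
  ultimately have "card C = 8"
    unfolding C' by (rule card_span3[OF abc])
  then show "binary_code n 3 C"
    using additive_span3[OF abc] C' by (simp add: binary_code_3_iff)
  have "x = 0\<^sub>v n" if "x \<in> C" "x \<bullet> a = 0" "x \<bullet> b = 0" "x \<bullet> c = 0" for x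
    using that unfolding C by (auto simp: dots)
  moreover have "a \<in> C" "b \<in> C" "c \<in> C" "0\<^sub>v n \<in> C"
    unfolding C by blast+
  moreover have "C \<subseteq> carrier_vec n"
    using abc unfolding C by auto
  ultimately show "LCD n C"
    unfolding LCD_def dual_code_def
    by (intro equalityI subsetI) (blast, auto intro: scalar_prod_left_zero)
qed

lemma scalar_prod_span3_zero:
  assumes "a \<in> carrier_vec n" "b \<in> carrier_vec n" "c \<in> carrier_vec n" "u \<in> carrier_vec n"
    and "u \<bullet> a = 0" "u \<bullet> b = 0" "u \<bullet> c = 0" "x \<in> span3 n a b c"
  shows "u \<bullet> x = 0"
  using assms(8) assms(1-7) unfolding span3_eq[OF assms(1-3)]
  by (auto simp: scalar_prod_add_distrib[of _ n])

lemma orthonormal_basisI: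
  assumes C: "additive n C" "card C = 8" and abc: "a \<in> C" "b \<in> C" "c \<in> C"
    and dots: "a \<bullet> a = 1" "b \<bullet> b = 1" "c \<bullet> c = 1" "a \<bullet> b = 0" "a \<bullet> c = 0" "b \<bullet> c = 0"
  shows "orthonormal_basis n C a b c"
proof -
  have carr: "a \<in> carrier_vec n" "b \<in> carrier_vec n" "c \<in> carrier_vec n"
    using C abc by (auto simp: additive_def)
  have onb: "orthonormal_basis n (span3 n a b c) a b c"
    using carr dots by (simp add: orthonormal_basis_def)
  have "card (span3 n a b c) = 8"
    using orthonormal_imp_LCD(1)[OF onb] by (simp add: binary_code_3_iff)
  moreover have "finite C" using C(2) card.infinite by force
  ultimately have "span3 n a b c = C"
    using span3_subset[OF C(1) abc] C(2) card_subset_eq by metis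
  then show ?thesis using onb by simp
qed

lemma bit_vec_add_eq_zero:
  fixes x :: "bit vec"
  assumes "x \<in> carrier_vec n" "y \<in> carrier_vec n" "x + y = 0\<^sub>v n"
  shows "x = y"
  using add_cancel_left_bit_vec[OF assms(2,1)] assms by simp

text \<open>
  The LCD property says that the inner product restricted to the code has trivial radical.
\<close>

lemma LCD_nondegenerate:
  assumes C: "additive n C" and LCD: "LCD n C"
    and u: "u \<in> C" "\<And>x. x \<in> C \<Longrightarrow> u \<bullet> x = 0"
  shows "u = 0\<^sub>v n"
proof -
  have "u \<in> C \<inter> dual_code n C"
    using C u by (auto simp: dual_code_def additive_def)
  then show ?thesis using LCD unfolding LCD_def by blast
qed

text \<open>
  If all words were self-orthogonal, the inner product would be an alternating form on a space of
  dimension three. Splitting off a hyperbolic plane then leaves a single vector, which is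
  orthogonal to everything.
\<close>

lemma exists_odd_vector:
  assumes C: "additive n C" "card C = 8" and LCD: "LCD n C"
  shows "\<exists>a\<in>C. a \<bullet> a = 1"
proof (rule ccontr)
  assume "\<not> ?thesis"
  then have even: "x \<bullet> x = 0" if "x \<in> C" for x
    using that by auto
  have carr: "x \<in> carrier_vec n" if "x \<in> C" for x
    using that C(1) by (auto simp: additive_def)
  have closed: "x + y \<in> C" if "x \<in> C" "y \<in> C" for x y
    using that C(1) by (auto simp: additive_def)
  obtain a where a: "a \<in> C" "a \<noteq> 0\<^sub>v n"
    using exists_not_in_small_set[OF C(2), of "0\<^sub>v n" "0\<^sub>v n" "0\<^sub>v n" "0\<^sub>v n"] by blast
  obtain b where b: "b \<in> C" "a \<bullet> b = 1"
    using LCD_nondegenerate[OF C(1) LCD a(1)] a(2) bit_not_zero_iff by blast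
  have "b \<noteq> 0\<^sub>v n" "b \<noteq> a"
    using b even[OF a(1)] carr[OF a(1)] by auto
  then have b': "b \<notin> {0\<^sub>v n, a}" by blast
  obtain c0 where c0: "c0 \<in> C" "c0 \<notin> {0\<^sub>v n, a, b, a + b}"
    using exists_not_in_small_set[OF C(2)] by blast
  note ab = carr[OF a(1)] carr[OF b(1)] and c0' = carr[OF c0(1)]
  have ba: "b \<bullet> a = 1" using b(2) comm_scalar_prod[OF ab] by simp
  \<comment> \<open>Project \<open>c0\<close> onto the orthogonal complement of the hyperbolic plane spanned by \<open>a\<close>, \<open>b\<close>.\<close>
  obtain s where s: "s \<in> {0\<^sub>v n, a, b, a + b}" "s \<bullet> a = c0 \<bullet> a" "s \<bullet> b = c0 \<bullet> b"
  proof (cases "c0 \<bullet> a = 0"; cases "c0 \<bullet> b = 0")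
    assume "c0 \<bullet> a = 0" "c0 \<bullet> b = 0"
    then show thesis using that[of "0\<^sub>v n"] ab by simp
  next
    assume "c0 \<bullet> a = 0" "c0 \<bullet> b \<noteq> 0"
    then show thesis using that[of a] ab b(2) even[OF a(1)] by simp
  next
    assume "c0 \<bullet> a \<noteq> 0" "c0 \<bullet> b = 0"
    then show thesis using that[of b] ab ba even[OF b(1)] by simp
  next
    assume "c0 \<bullet> a \<noteq> 0" "c0 \<bullet> b \<noteq> 0"
    then show thesis
      using that[of "a + b"] ab ba b(2) even[OF a(1)] even[OF b(1)]
      by (simp add: add_scalar_prod_distrib[of _ n])
  qed
  have "s \<in> C" using s(1) a(1) b(1) closed C(1) by (auto simp: additive_def)
  define c where "c = c0 + s"
  have c: "c \<in> C" unfolding c_def using c0(1) \<open>s \<in> C\<close> closed by blast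
  have "c \<bullet> a = 0" "c \<bullet> b = 0"
    unfolding c_def using ab c0' carr[OF \<open>s \<in> C\<close>] s(2,3)
    by (simp_all add: add_scalar_prod_distrib[of _ n])
  moreover have "c \<bullet> c = 0" by (rule even[OF c])
  moreover have "c \<notin> {0\<^sub>v n, a, b, a + b}"
  proof
    assume "c \<in> {0\<^sub>v n, a, b, a + b}"
    have "c = 0\<^sub>v n"
      using \<open>c \<in> {0\<^sub>v n, a, b, a + b}\<close> \<open>c \<bullet> a = 0\<close> \<open>c \<bullet> b = 0\<close> ab ba b(2) even[OF a(1)] even[OF b(1)]
      by (auto simp: add_scalar_prod_distrib[of _ n])
    then have "c0 = s"
      unfolding c_def using bit_vec_add_eq_zero[OF c0' carr[OF \<open>s \<in> C\<close>]] by blast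
    then show False using s(1) c0(2) by blast
  qed
  moreover have "C = span3 n a b c"
    by (rule eq_span3[OF C a(1) b(1) c a(2) b' \<open>c \<notin> {0\<^sub>v n, a, b, a + b}\<close>])
  ultimately have "c \<bullet> x = 0" if "x \<in> C" for x
    using scalar_prod_span3_zero[OF ab carr[OF c] carr[OF c]] that by blast
  then have "c = 0\<^sub>v n" by (rule LCD_nondegenerate[OF C(1) LCD c])
  then show False using \<open>c \<notin> {0\<^sub>v n, a, b, a + b}\<close> by blast
qed

text \<open>
  Split off an odd vector \<open>a\<close>. The form on the two-dimensional complement spanned by \<open>u\<close>, \<open>v\<close> is
  nondegenerate, which leaves four Gram matrices; in the three odd ones the complement has an
  orthonormal basis, and in the alternating one it acquires one after mixing with \<open>a\<close>.
\<close>

lemma LCD_imp_orthonormal: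
  assumes "binary_code n 3 C" and LCD: "LCD n C"
  shows "\<exists>a b c. orthonormal_basis n C a b c"
proof -
  have C: "additive n C" "card C = 8"
    using assms(1) by (simp_all add: binary_code_3_iff)
  have carr: "x \<in> carrier_vec n" if "x \<in> C" for x
    using that C(1) by (auto simp: additive_def)
  have closed: "x + y \<in> C" if "x \<in> C" "y \<in> C" for x y
    using that C(1) by (auto simp: additive_def)
  obtain a where a: "a \<in> C" "a \<bullet> a = 1"
    using exists_odd_vector[OF C LCD] by blast
  have a0: "a \<noteq> 0\<^sub>v n" using a(2) carr[OF a(1)] by auto
  have orthogonalize: "\<exists>y\<in>C. y \<bullet> a = 0 \<and> y \<in> {x, x + a}" if "x \<in> C" for x
  proof (cases "x \<bullet> a = 0")
    case True
    then show ?thesis using that by blast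
  next
    case False
    then have "(x + a) \<bullet> a = 0"
      using carr[OF that] carr[OF a(1)] a(2) by (simp add: add_scalar_prod_distrib[of _ n])
    then show ?thesis using closed[OF that a(1)] by blast
  qed
  have cancel: "x + y + y = x" if "x \<in> C" "y \<in> C" for x y
    using add_cancel_left_bit_vec[OF carr[OF that(1)] carr[OF that(2)]]
      comm_add_vec[OF carr[OF that(2)] carr[OF closed[OF that]]]
      comm_add_vec[OF carr[OF that(1)] carr[OF that(2)]] by simp
  obtain u0 where u0: "u0 \<in> C" "u0 \<notin> {0\<^sub>v n, a, a, a}"
    using exists_not_in_small_set[OF C(2)] by blast
  obtain u where u: "u \<in> C" "u \<bullet> a = 0" "u \<in> {u0, u0 + a}"
    using orthogonalize[OF u0(1)] by blast
  have u': "u \<notin> {0\<^sub>v n, a}"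
  proof -
    have "u \<noteq> a" using u(2) a(2) by auto
    moreover have "u \<noteq> 0\<^sub>v n"
      using u(3) u0(2) bit_vec_add_eq_zero[OF carr[OF u0(1)] carr[OF a(1)]] by auto
    ultimately show ?thesis by blast
  qed
  obtain v0 where v0: "v0 \<in> C" "v0 \<notin> {0\<^sub>v n, a, u, a + u}"
    using exists_not_in_small_set[OF C(2)] by blast
  obtain v where v: "v \<in> C" "v \<bullet> a = 0" "v \<in> {v0, v0 + a}"
    using orthogonalize[OF v0(1)] by blast
  note auv = carr[OF a(1)] carr[OF u(1)] carr[OF v(1)]
  have v': "v \<notin> {0\<^sub>v n, a, u, a + u}"
  proof
    assume "v \<in> {0\<^sub>v n, a, u, a + u}"
    moreover have "v0 \<in> {v, v + a}" using v(3) cancel[OF v0(1) a(1)] by auto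
    moreover have "a + u + a = u"
      using comm_add_vec[OF auv(1,2)] cancel[OF u(1) a(1)] by simp
    moreover have "u + a = a + u" by (rule comm_add_vec[OF auv(2,1)])
    ultimately show False using v0(2) auv by auto
  qed
  have C_eq: "C = span3 n a u v"
    by (rule eq_span3[OF C a(1) u(1) v(1) a0 u' v'])
  have isolated: "x = 0\<^sub>v n" if x: "x \<in> C" "x \<bullet> a = 0" "x \<bullet> u = 0" "x \<bullet> v = 0" for x
    using scalar_prod_span3_zero[OF auv carr[OF x(1)] x(2-4)] C_eq
    by (intro LCD_nondegenerate[OF C(1) LCD x(1)]) blast
  define p q r where "p = u \<bullet> u" and "q = u \<bullet> v" and "r = v \<bullet> v"
  have sym: "a \<bullet> u = 0" "a \<bullet> v = 0" "v \<bullet> u = q"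
    using u(2) v(2) q_def comm_scalar_prod[OF auv(1,2)] comm_scalar_prod[OF auv(1,3)]
      comm_scalar_prod[OF auv(3,2)] by simp_all
  note dots = add_scalar_prod_distrib[of _ n] scalar_prod_add_distrib[of _ n]
    p_def[symmetric] q_def[symmetric] r_def[symmetric] sym a(2) u(2) v(2) auv
  have uv: "u + v \<in> C" "u + v \<noteq> 0\<^sub>v n"
    using closed[OF u(1) v(1)] bit_vec_add_eq_zero[OF auv(2,3)] v' by auto
  have nonzero: "u \<noteq> 0\<^sub>v n" "v \<noteq> 0\<^sub>v n" using u' v' by auto
  have "\<not> (p = 0 \<and> q = 0)"
    using isolated[OF u(1)] nonzero(1) by (auto simp: dots)
  moreover have "\<not> (q = 0 \<and> r = 0)"
    using isolated[OF v(1)] nonzero(2) by (auto simp: dots)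
  moreover have "\<not> (p = 1 \<and> q = 1 \<and> r = 1)"
    using isolated[OF uv(1)] uv(2) by (auto simp: dots)
  ultimately consider "p = 1 \<and> q = 0 \<and> r = 1" | "p = 1 \<and> q = 1 \<and> r = 0"
    | "p = 0 \<and> q = 1 \<and> r = 1" | "p = 0 \<and> q = 1 \<and> r = 0"
    by (cases "p = 0"; cases "q = 0"; cases "r = 0") auto
  then show ?thesis
  proof cases
    case 1
    then have "orthonormal_basis n C a u v"
      by (intro orthonormal_basisI[OF C] a u v) (simp_all add: dots)
    then show ?thesis by blast
  next
    case 2
    then have "orthonormal_basis n C a u (u + v)"
      by (intro orthonormal_basisI[OF C] a u uv) (simp_all add: dots)
    then show ?thesis by blast
  next
    case 3
    then have "orthonormal_basis n C a v (u + v)"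
      by (intro orthonormal_basisI[OF C] a v uv) (simp_all add: dots)
    then show ?thesis by blast
  next
    \<comment> \<open>The complement of \<open>a\<close> is a hyperbolic plane; it becomes orthonormal after adding \<open>a\<close>.\<close>
    case 4
    then have "orthonormal_basis n C (a + u) (a + v) (a + (u + v))"
      by (intro orthonormal_basisI[OF C] closed a u v uv) (simp_all add: dots)
    then show ?thesis by blast
  qed
qed

section \<open>The weight profile\<close>

text \<open>
  Reordering an orthonormal basis permutes the three pairs (weight of a basis vector, weight of the
  sum of the other two) and fixes the weight of the total sum. Taking the pairs as a multiset
  removes the dependence on the order.
\<close>

definition profile :: "bit vec \<Rightarrow> bit vec \<Rightarrow> bit vec \<Rightarrow> (nat \<times> nat) multiset \<times> nat" where
  "profile a b c =
    ({#(hamming_weight a, hamming_weight (b + c)), (hamming_weight b, hamming_weight (a + c)),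
       (hamming_weight c, hamming_weight (a + b))#}, hamming_weight (a + b + c))"

lemma orthonormal_basis_swap12:
  assumes "orthonormal_basis n C a b c"
  shows "orthonormal_basis n C b a c" "profile b a c = profile a b c"
proof -
  note onb = orthonormal_basisD[OF assms]
  have comm: "b + a = a + b" using onb(1,2) by (intro comm_add_vec)
  show "profile b a c = profile a b c"
    by (simp add: profile_def comm add_mset_commute)
  have "span3 n b a c = C"
    unfolding onb(13) span3_eq[OF onb(2,1,3)] comm by blast
  then show "orthonormal_basis n C b a c"
    using onb(1-12) by (simp add: orthonormal_basis_def)
qed

lemma orthonormal_basis_swap23:
  assumes "orthonormal_basis n C a b c"
  shows "orthonormal_basis n C a c b" "profile a c b = profile a b c"
proof -
  note onb = orthonormal_basisD[OF assms]
  have comm: "c + b = b + c" "a + c + b = a + b + c"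
    using onb(1-3) comm_add_vec[OF onb(2,3)] by simp_all
  show "profile a c b = profile a b c"
    by (simp add: profile_def comm add_mset_commute)
  have "span3 n a c b = C"
    unfolding onb(13) span3_eq[OF onb(1,3,2)] comm by blast
  then show "orthonormal_basis n C a c b"
    using onb(1-12) by (simp add: orthonormal_basis_def)
qed

text \<open>
  The words of odd weight are \<open>a\<close>, \<open>b\<close>, \<open>c\<close> and \<open>a + b + c\<close>, and the last has inner product 1 with the
  others. So an orthonormal basis is unique up to order.
\<close>

lemma profile_unique:
  assumes onb: "orthonormal_basis n C a b c" and onb': "orthonormal_basis n C a' b' c'"
  shows "profile a' b' c' = profile a b c"
proof -
  note abc = orthonormal_basisD(1-3)[OF onb] and C = orthonormal_basisD(13)[OF onb]
  note dots = add_scalar_prod_distrib[of _ n] scalar_prod_add_distrib[of _ n]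
    orthonormal_basisD(4-12)[OF onb] abc
  have odd: "x \<in> {a, b, c, a + b + c}" if "x \<in> C" "x \<bullet> x = 1" for x
    using that unfolding C by (auto simp: dots)
  have "{a', b', c'} \<subseteq> C" using orthonormal_basisD(13)[OF onb'] by blast
  then have mem: "a' \<in> {a, b, c, a + b + c}" "b' \<in> {a, b, c, a + b + c}"
      "c' \<in> {a, b, c, a + b + c}"
    using odd orthonormal_basisD(4-6)[OF onb'] by blast+
  have "x \<bullet> x = 1" "x \<bullet> (a + b + c) = 1" "(a + b + c) \<bullet> x = 1"
    if "x \<in> {a, b, c, a + b + c}" for x
    using that by (elim insertE emptyE; simp add: dots)+
  then have "x \<noteq> y" "x \<noteq> a + b + c" "y \<noteq> a + b + c"
    if "x \<bullet> y = 0" "x \<in> {a, b, c, a + b + c}" "y \<in> {a, b, c, a + b + c}" for x y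
    using that zero_neq_one by metis+
  then have "a' \<noteq> b'" "a' \<noteq> c'" "b' \<noteq> c'"
    and "a' \<noteq> a + b + c" "b' \<noteq> a + b + c" "c' \<noteq> a + b + c"
    using mem orthonormal_basisD(7-9)[OF onb'] by blast+
  then consider "a' = a" "b' = b" "c' = c" | "a' = a" "b' = c" "c' = b"
    | "a' = b" "b' = a" "c' = c" | "a' = b" "b' = c" "c' = a"
    | "a' = c" "b' = a" "c' = b" | "a' = c" "b' = b" "c' = a"
    using mem by blast
  then show ?thesis
    using orthonormal_basis_swap12[OF onb] orthonormal_basis_swap23[OF onb]
      orthonormal_basis_swap12(2)[OF orthonormal_basis_swap23(1)[OF onb]]
      orthonormal_basis_swap23(2)[OF orthonormal_basis_swap12(1)[OF onb]]
      orthonormal_basis_swap12(2)[OF orthonormal_basis_swap23(1)[OF orthonormal_basis_swap12(1)[OF onb]]]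
    by cases simp_all
qed

section \<open>Weights determine a code up to permutation\<close>

lemma permute_coords_carrier [simp]:
  "x \<in> carrier_vec n \<Longrightarrow> permute_coords p x \<in> carrier_vec n"
  by (simp add: permute_coords_def)

lemma permute_coords_add:
  assumes "p permutes {..<n}" "x \<in> carrier_vec n" "y \<in> carrier_vec n"
  shows "permute_coords p (x + y) = permute_coords p x + permute_coords p y"
proof (rule eq_vecI)
  fix i assume "i < dim_vec (permute_coords p x + permute_coords p y)"
  then have i: "i < n" using assms(3) by (simp add: permute_coords_def)
  then have "p i < n" using permutes_in_image[OF assms(1), of i] by simp
  then show "permute_coords p (x + y) $ i = (permute_coords p x + permute_coords p y) $ i"
    using i assms(2,3) by (simp add: permute_coords_def)
qed (use assms in \<open>simp add: permute_coords_def\<close>)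

lemma hamming_weight_permute:
  assumes "p permutes {..<n}" "x \<in> carrier_vec n"
  shows "hamming_weight (permute_coords p x) = hamming_weight x"
proof -
  have "hamming_weight (permute_coords p x) = (\<Sum>i<n. of_bool (x $ p i \<noteq> 0))"
    unfolding hamming_weight_eq_sum[OF permute_coords_carrier[OF assms(2)]]
    using assms(2) by (intro sum.cong) (auto simp: permute_coords_def)
  also have "\<dots> = hamming_weight x"
    unfolding hamming_weight_eq_sum[OF assms(2)]
    by (rule sum.permute[OF assms(1), of "\<lambda>i. of_bool (x $ i \<noteq> 0)", unfolded o_def, symmetric])
  finally show ?thesis .
qed

lemma scalar_prod_permute:
  assumes "p permutes {..<n}" "x \<in> carrier_vec n" "y \<in> carrier_vec n"
  shows "permute_coords p x \<bullet> permute_coords p y = x \<bullet> y"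
proof -
  have "permute_coords p x \<bullet> permute_coords p y = (\<Sum>i<n. x $ p i * y $ p i)"
    using assms(2,3) by (auto simp: scalar_prod_def permute_coords_def atLeast0LessThan
        simp del: mult_bit_eq_and intro!: sum.cong)
  also have "\<dots> = x \<bullet> y"
    using sum.permute[OF assms(1), of "\<lambda>i. x $ i * y $ i"] assms(3)
    by (simp only: o_def scalar_prod_def atLeast0LessThan carrier_vecD)
  finally show ?thesis .
qed

lemma orthonormal_basis_permute:
  assumes p: "p permutes {..<n}" and onb: "orthonormal_basis n C a b c"
  shows "orthonormal_basis n (permute_coords p ` C)
      (permute_coords p a) (permute_coords p b) (permute_coords p c)"
    and "profile (permute_coords p a) (permute_coords p b) (permute_coords p c) = profile a b c"
proof -
  note abc = orthonormal_basisD(1-3)[OF onb] and C = orthonormal_basisD(13)[OF onb]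
  have zero: "permute_coords p (0\<^sub>v n) = 0\<^sub>v n"
    by (rule eq_vecI) (auto simp: permute_coords_def permutes_in_image[OF p, simplified])
  have "permute_coords p ` C = span3 n (permute_coords p a) (permute_coords p b) (permute_coords p c)"
    unfolding C span3_eq[OF permute_coords_carrier[OF abc(1)] permute_coords_carrier[OF abc(2)]
      permute_coords_carrier[OF abc(3)]]
    by (simp only: image_insert image_empty zero permute_coords_add[OF p] abc add_carrier_vec)
  then show "orthonormal_basis n (permute_coords p ` C)
      (permute_coords p a) (permute_coords p b) (permute_coords p c)"
    unfolding orthonormal_basis_def
    using abc orthonormal_basisD(4-9)[OF onb] by (simp add: scalar_prod_permute[OF p])
  show "profile (permute_coords p a) (permute_coords p b) (permute_coords p c) = profile a b c"
    unfolding profile_def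
    using abc by (simp add: hamming_weight_permute[OF p] permute_coords_add[OF p, symmetric])
qed

text \<open>
  The columns of the generator matrix with rows \<open>a\<close>, \<open>b\<close>, \<open>c\<close>.
\<close>

definition columns :: "nat \<Rightarrow> bit vec \<Rightarrow> bit vec \<Rightarrow> bit vec \<Rightarrow> (bit \<times> bit \<times> bit) list" where
  "columns n a b c = map (\<lambda>i. (a $ i, b $ i, c $ i)) [0..<n]"

text \<open>
  Inversion of the map from column multiplicities to weights. For \<open>v \<noteq> 0\<close> exactly four of the
  seven nonzero linear forms take the value 1 at \<open>v\<close>; a nonzero column different from \<open>v\<close> is
  counted equally often by these four and by the other three, so the signed sum isolates \<open>v\<close>.
\<close>

lemma count_columns:
  assumes "a \<in> carrier_vec n" "b \<in> carrier_vec n" "c \<in> carrier_vec n"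
  defines "N \<equiv> \<lambda>v. 4 * int (count (mset (columns n a b c)) v)"
    and "w \<equiv> \<lambda>x. int (hamming_weight x)"
  shows "N (1, 0, 0) = w a + w (a + b) + w (a + c) + w (a + b + c) - w b - w c - w (b + c)"
    and "N (0, 1, 0) = w b + w (a + b) + w (b + c) + w (a + b + c) - w a - w c - w (a + c)"
    and "N (0, 0, 1) = w c + w (a + c) + w (b + c) + w (a + b + c) - w a - w b - w (a + b)"
    and "N (1, 1, 0) = w a + w b + w (a + c) + w (b + c) - w c - w (a + b) - w (a + b + c)"
    and "N (1, 0, 1) = w a + w c + w (a + b) + w (b + c) - w b - w (a + c) - w (a + b + c)"
    and "N (0, 1, 1) = w b + w c + w (a + b) + w (a + c) - w a - w (b + c) - w (a + b + c)"
    and "N (1, 1, 1) = w a + w b + w c + w (a + b + c) - w (a + b) - w (a + c) - w (b + c)"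
    and "N (0, 0, 0) = 4 * int n - w a - w b - w c - w (a + b) - w (a + c) - w (b + c) - w (a + b + c)"
proof -
  have N: "N v = (\<Sum>i<n. 4 * of_bool (a $ i = fst v \<and> b $ i = fst (snd v) \<and> c $ i = snd (snd v)))" for v
  proof -
    have "count (mset (columns n a b c)) v =
        card {i. i < n \<and> (a $ i, b $ i, c $ i) = v}"
      unfolding columns_def count_mset count_list_eq_length_filter length_filter_conv_card
      by (rule arg_cong[of _ _ card]) auto
    also have "\<dots> = card ({i. a $ i = fst v \<and> b $ i = fst (snd v) \<and> c $ i = snd (snd v)} \<inter> {..<n})"
      by (rule arg_cong[of _ _ card]) auto
    also have "int \<dots> = (\<Sum>i<n. of_bool (a $ i = fst v \<and> b $ i = fst (snd v) \<and> c $ i = snd (snd v)))"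
      by (simp only: sum_of_bool_eq finite_lessThan Int_commute)
    finally show ?thesis unfolding N_def by (simp only: sum_distrib_left)
  qed
  have w: "w x = (\<Sum>i<n. of_bool (x $ i \<noteq> 0))" if "x \<in> carrier_vec n" for x
    unfolding w_def hamming_weight_eq_sum[OF that] of_nat_sum of_nat_of_bool ..
  have nonzero: "(x + y) $ i \<noteq> 0 \<longleftrightarrow> (x $ i \<noteq> 0) \<noteq> (y $ i \<noteq> 0)"
    if "i < n" "y \<in> carrier_vec n" for x y :: "bit vec" and i
    using that add_nonzero_bit by (metis index_add_vec(1) carrier_vecD)
  have ws: "w a = (\<Sum>i<n. of_bool (a $ i \<noteq> 0))" "w b = (\<Sum>i<n. of_bool (b $ i \<noteq> 0))"
    "w c = (\<Sum>i<n. of_bool (c $ i \<noteq> 0))"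
    "w (a + b) = (\<Sum>i<n. of_bool ((a $ i \<noteq> 0) \<noteq> (b $ i \<noteq> 0)))"
    "w (a + c) = (\<Sum>i<n. of_bool ((a $ i \<noteq> 0) \<noteq> (c $ i \<noteq> 0)))"
    "w (b + c) = (\<Sum>i<n. of_bool ((b $ i \<noteq> 0) \<noteq> (c $ i \<noteq> 0)))"
    "w (a + b + c) = (\<Sum>i<n. of_bool (((a $ i \<noteq> 0) \<noteq> (b $ i \<noteq> 0)) \<noteq> (c $ i \<noteq> 0)))"
    by (simp_all only: w assms(1-3) add_carrier_vec)
      (rule sum.cong; simp only: nonzero lessThan_iff assms(1-3) add_carrier_vec refl)+
  have n: "4 * int n = (\<Sum>i<n. 4)" by simp
  show "N (1, 0, 0) = w a + w (a + b) + w (a + c) + w (a + b + c) - w b - w c - w (b + c)"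
    and "N (0, 1, 0) = w b + w (a + b) + w (b + c) + w (a + b + c) - w a - w c - w (a + c)"
    and "N (0, 0, 1) = w c + w (a + c) + w (b + c) + w (a + b + c) - w a - w b - w (a + b)"
    and "N (1, 1, 0) = w a + w b + w (a + c) + w (b + c) - w c - w (a + b) - w (a + b + c)"
    and "N (1, 0, 1) = w a + w c + w (a + b) + w (b + c) - w b - w (a + c) - w (a + b + c)"
    and "N (0, 1, 1) = w b + w c + w (a + b) + w (a + c) - w a - w (b + c) - w (a + b + c)"
    and "N (1, 1, 1) = w a + w b + w c + w (a + b + c) - w (a + b) - w (a + c) - w (b + c)"
    and "N (0, 0, 0) = 4 * int n - w a - w b - w c - w (a + b) - w (a + c) - w (b + c) - w (a + b + c)"
    unfolding N ws n sum.distrib[symmetric] sum_subtractf[symmetric] fst_conv snd_conv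
    by (intro sum.cong refl; auto simp: of_bool_def)+
qed

text \<open>
  Equal weights give equal column multiplicities, and matrices with the same multiset of columns
  differ by a permutation of the coordinates.
\<close>

lemma same_weights_imp_permutation:
  assumes abc: "a \<in> carrier_vec n" "b \<in> carrier_vec n" "c \<in> carrier_vec n"
    and abc': "a' \<in> carrier_vec n" "b' \<in> carrier_vec n" "c' \<in> carrier_vec n"
    and "hamming_weight a' = hamming_weight a" "hamming_weight b' = hamming_weight b"
      "hamming_weight c' = hamming_weight c"
      "hamming_weight (a' + b') = hamming_weight (a + b)"
      "hamming_weight (a' + c') = hamming_weight (a + c)"
      "hamming_weight (b' + c') = hamming_weight (b + c)"
      "hamming_weight (a' + b' + c') = hamming_weight (a + b + c)"
  shows "\<exists>p. p permutes {..<n} \<and> a' = permute_coords p a \<and> b' = permute_coords p b \<and>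
    c' = permute_coords p c"
proof -
  have "count (mset (columns n a' b' c')) v = count (mset (columns n a b c)) v" for v
  proof -
    have "b = 0 \<or> b = 1" for b :: bit by (cases "b = 0") simp_all
    then have "v \<in> {0, 1} \<times> {0, 1} \<times> {0, 1}" by (cases v) blast
    then have "v \<in> {(0, 0, 0), (0, 0, 1), (0, 1, 0), (0, 1, 1), (1, 0, 0), (1, 0, 1), (1, 1, 0), (1, 1, 1)}"
      by blast
    then have "4 * int (count (mset (columns n a' b' c')) v) = 4 * int (count (mset (columns n a b c)) v)"
      by (elim insertE emptyE; simp only: count_columns[OF abc] count_columns[OF abc'] assms(7-13))
    then show ?thesis by simp
  qed
  then have "mset (columns n a b c) = mset (columns n a' b' c')"
    by (simp add: multiset_eq_iff)
  then obtain p where p: "p permutes {..<length (columns n a b c)}"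
      "permute_list p (columns n a b c) = columns n a' b' c'"
    by (metis mset_eq_permutation)
  have len: "length (columns n a b c) = n" by (simp add: columns_def)
  have eq: "(a' $ i, b' $ i, c' $ i) = (a $ p i, b $ p i, c $ p i)" if i: "i < n" for i
  proof -
    have "p i < n" using permutes_in_image[OF p(1), of i] i len by simp
    have "(a' $ i, b' $ i, c' $ i) = columns n a' b' c' ! i"
      using i by (simp add: columns_def)
    also have "\<dots> = permute_list p (columns n a b c) ! i" by (simp only: p(2))
    also have "\<dots> = columns n a b c ! p i"
      using i len by (intro permute_list_nth[OF p(1)]) simp
    also have "\<dots> = (a $ p i, b $ p i, c $ p i)"
      using \<open>p i < n\<close> by (simp add: columns_def)
    finally show ?thesis .
  qed
  show ?thesis
  proof (intro exI[of _ p] conjI)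
    show "p permutes {..<n}" using p(1) len by simp
    show "a' = permute_coords p a" "b' = permute_coords p b" "c' = permute_coords p c"
      using abc abc' eq by (auto intro!: eq_vecI simp: permute_coords_def)
  qed
qed

lemma mset3_eq_iff:
  "{#x, y, z#} = {#x', y', z'#} \<longleftrightarrow>
    x = x' \<and> y = y' \<and> z = z' \<or> x = x' \<and> y = z' \<and> z = y' \<or>
    x = y' \<and> y = x' \<and> z = z' \<or> x = y' \<and> y = z' \<and> z = x' \<or>
    x = z' \<and> y = x' \<and> z = y' \<or> x = z' \<and> y = y' \<and> z = x'"
  (is "?L \<longleftrightarrow> ?R")
proof
  assume eq: ?L
  have pair: "u = u' \<and> v = v' \<or> u = v' \<and> v = u'" if "{#u, v#} = {#u', v'#}" for u v u' v' :: 'a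
    using that by (auto simp: add_eq_conv_ex)
  have "x \<in># {#x', y', z'#}" by (simp flip: eq)
  then consider "x = x'" | "x = y'" | "x = z'" by auto
  then show ?R
  proof cases
    case 1
    then show ?thesis using eq pair[of y z y' z'] by auto
  next
    case 2
    have "add_mset y' {#y, z#} = add_mset y' {#x', z'#}"
      using eq unfolding 2 add_mset_commute[of x' y'] .
    then have "{#y, z#} = {#x', z'#}" by (simp only: add_mset_add_mset_same_iff)
    then show ?thesis using 2 pair by blast
  next
    case 3
    have "add_mset z' {#y, z#} = add_mset z' {#x', y'#}"
      using eq unfolding 3 add_mset_commute[of y' z'] add_mset_commute[of x' z'] .
    then have "{#y, z#} = {#x', y'#}" by (simp only: add_mset_add_mset_same_iff)
    then show ?thesis using 3 pair by blast
  qed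
qed (elim disjE conjE; simp add: add_mset_commute)

text \<open>
  The profile is a complete invariant: an equality of profiles matches the three pairs in some
  order, and after reordering one basis accordingly all seven weights agree.
\<close>

lemma code_equiv_iff_profile:
  assumes onb: "orthonormal_basis n C a b c" and onb': "orthonormal_basis n D a' b' c'"
  shows "(C, D) \<in> code_equiv n 3 \<longleftrightarrow> profile a b c = profile a' b' c'"
proof
  assume "(C, D) \<in> code_equiv n 3"
  then obtain p where p: "p permutes {..<n}" "D = permute_coords p ` C"
    by (auto simp: code_equiv_def)
  show "profile a b c = profile a' b' c'"
    using profile_unique[OF orthonormal_basis_permute(1)[OF p(1) onb, folded p(2)] onb']
      orthonormal_basis_permute(2)[OF p(1) onb] by simp
next
  let ?w = "\<lambda>a b c. (hamming_weight a, hamming_weight b, hamming_weight c,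
    hamming_weight (b + c), hamming_weight (a + c), hamming_weight (a + b))"
  assume eq: "profile a b c = profile a' b' c'"
  have "\<exists>x y z. orthonormal_basis n D x y z \<and> profile x y z = profile a' b' c' \<and> ?w x y z = ?w a b c"
  proof -
    note s12 = orthonormal_basis_swap12 and s23 = orthonormal_basis_swap23
    have comm: "b' + a' = a' + b'" "c' + a' = a' + c'" "c' + b' = b' + c'"
      using orthonormal_basisD(1-3)[OF onb'] comm_add_vec by blast+
    from eq have "{#(hamming_weight a, hamming_weight (b + c)), (hamming_weight b, hamming_weight (a + c)),
        (hamming_weight c, hamming_weight (a + b))#} =
      {#(hamming_weight a', hamming_weight (b' + c')), (hamming_weight b', hamming_weight (a' + c')),
        (hamming_weight c', hamming_weight (a' + b'))#}"
      unfolding profile_def by (simp only: prod.inject)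
    then have "?w a b c \<in> {?w a' b' c', ?w b' a' c', ?w a' c' b', ?w b' c' a', ?w c' a' b', ?w c' b' a'}"
      unfolding mset3_eq_iff comm by (elim disjE) simp_all
    then consider "?w a b c = ?w a' b' c'" | "?w a b c = ?w b' a' c'" | "?w a b c = ?w a' c' b'"
      | "?w a b c = ?w b' c' a'" | "?w a b c = ?w c' a' b'" | "?w a b c = ?w c' b' a'"
      by (elim insertE emptyE)
    then show ?thesis
    proof cases
      case 1 then show ?thesis using onb' by metis
    next
      case 2 then show ?thesis using s12[OF onb'] by metis
    next
      case 3 then show ?thesis using s23[OF onb'] by metis
    next
      case 4 then show ?thesis
        using s12[OF onb'] s23[OF s12(1)[OF onb']] by metis
    next
      case 5 then show ?thesis
        using s23[OF onb'] s12[OF s23(1)[OF onb']] by metis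
    next
      case 6 then show ?thesis
        using s12[OF onb'] s23[OF s12(1)[OF onb']] s12[OF s23(1)[OF s12(1)[OF onb']]] by metis
    qed
  qed
  then obtain x y z where xyz: "orthonormal_basis n D x y z" "profile x y z = profile a b c"
      "?w x y z = ?w a b c"
    using eq by auto
  have "\<exists>p. p permutes {..<n} \<and> x = permute_coords p a \<and> y = permute_coords p b \<and>
      z = permute_coords p c"
    using xyz(2,3) by (intro same_weights_imp_permutation orthonormal_basisD(1-3)[OF onb]
        orthonormal_basisD(1-3)[OF xyz(1)]) (auto simp: profile_def)
  then obtain p where p: "p permutes {..<n}" "x = permute_coords p a" "y = permute_coords p b"
      "z = permute_coords p c" by blast
  have "D = permute_coords p ` C"
    using orthonormal_basis_permute(1)[OF p(1) onb] xyz(1) p(2-4)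
    by (simp add: orthonormal_basis_def)
  then show "(C, D) \<in> code_equiv n 3"
    using p(1) orthonormal_imp_LCD(1)[OF onb] orthonormal_imp_LCD(1)[OF onb']
    by (auto simp: code_equiv_def)
qed

section \<open>Realizing prescribed weights\<close>

text \<open>
  The weights of \<open>a\<close>, \<open>b\<close>, \<open>c\<close>, \<open>b + c\<close>, \<open>a + c\<close>, \<open>a + b\<close>, \<open>a + b + c\<close>, in this order; the fourth to
  sixth entries are complementary to the first three.
\<close>

type_synonym weights7 = "nat \<times> nat \<times> nat \<times> nat \<times> nat \<times> nat \<times> nat"

definition weight_tuple :: "bit vec \<Rightarrow> bit vec \<Rightarrow> bit vec \<Rightarrow> weights7" where
  "weight_tuple a b c =
    (hamming_weight a, hamming_weight b, hamming_weight c,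
     hamming_weight (b + c), hamming_weight (a + c), hamming_weight (a + b), hamming_weight (a + b + c))"

text \<open>
  The congruences satisfied by the weights in a code with an orthonormal basis: basis vectors have
  odd weight, and weights of orthogonal vectors add up modulo 4.
\<close>

definition orthonormal_weights :: "weights7 \<Rightarrow> bool" where
  "orthonormal_weights = (\<lambda>(x1, x2, x3, y1, y2, y3, z).
     odd x1 \<and> odd x2 \<and> odd x3 \<and> y1 mod 4 = (x2 + x3) mod 4 \<and> y2 mod 4 = (x1 + x3) mod 4 \<and>
     y3 mod 4 = (x1 + x2) mod 4 \<and> z mod 4 = (x1 + x2 + x3) mod 4)"

lemma orthonormal_basis_iff_weights:
  assumes abc: "a \<in> carrier_vec n" "b \<in> carrier_vec n" "c \<in> carrier_vec n"
  shows "orthonormal_basis n (span3 n a b c) a b c \<longleftrightarrow> orthonormal_weights (weight_tuple a b c)"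
proof -
  have one: "x \<bullet> x = 1 \<longleftrightarrow> odd (hamming_weight x)" if "x \<in> carrier_vec n" for x :: "bit vec"
    using scalar_prod_self_eq_zero_iff[OF that] bit_not_zero_iff by metis
  have "(a + b) \<bullet> c = 0" if "a \<bullet> c = 0" "b \<bullet> c = 0"
    using that abc by (simp add: add_scalar_prod_distrib[of _ n])
  moreover have "(a + b) \<bullet> c = 0 \<longleftrightarrow>
      hamming_weight (a + b + c) mod 4 = (hamming_weight a + hamming_weight b + hamming_weight c) mod 4"
    if "hamming_weight (a + b) mod 4 = (hamming_weight a + hamming_weight b) mod 4"
    using scalar_prod_eq_zero_iff[OF add_carrier_vec[OF abc(1,2)] abc(3)] mod_add_cong[OF that refl]
    by metis
  ultimately show ?thesis
    unfolding orthonormal_basis_def orthonormal_weights_def weight_tuple_def prod.case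
    using abc one scalar_prod_eq_zero_iff by metis
qed

text \<open>
  Every nonzero column has a 1 in exactly four of the seven nonzero words.
\<close>

lemma sum_weights_eq:
  assumes "a \<in> carrier_vec n" "b \<in> carrier_vec n" "c \<in> carrier_vec n"
  shows "hamming_weight a + hamming_weight b + hamming_weight c + hamming_weight (b + c) +
      hamming_weight (a + c) + hamming_weight (a + b) + hamming_weight (a + b + c) +
      4 * count (mset (columns n a b c)) (0, 0, 0) = 4 * n"
  using count_columns(8)[OF assms] by linarith

lemma hamming_weight_vec_of_list:
  "hamming_weight (vec_of_list xs) = length (filter (\<lambda>x. x \<noteq> 0) xs)"
  unfolding hamming_weight_def length_filter_conv_card
  by (rule arg_cong[of _ _ card]) (auto simp: vec_of_list_index)

lemma vec_of_list_add:
  "vec_of_list (map f xs) + vec_of_list (map g xs) = vec_of_list (map (\<lambda>v. f v + g v) xs)"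
  by (rule eq_vecI) (simp_all add: vec_of_list_index)

text \<open>
  The rows of a matrix with prescribed column multiplicities.
\<close>

lemma exists_words_with_column_counts:
  fixes m100 m010 m001 m110 m101 m011 m111 :: nat
  assumes n: "n = m100 + m010 + m001 + m110 + m101 + m011 + m111"
  shows "\<exists>a\<in>carrier_vec n. \<exists>b\<in>carrier_vec n. \<exists>c\<in>carrier_vec n. weight_tuple a b c =
    (m100 + m110 + m101 + m111, m010 + m110 + m011 + m111, m001 + m101 + m011 + m111,
     m010 + m001 + m110 + m101, m100 + m001 + m110 + m011, m100 + m010 + m101 + m011,
     m100 + m010 + m001 + m111)"
proof -
  define cols :: "(bit \<times> bit \<times> bit) list" where
    "cols = replicate m100 (1, 0, 0) @ replicate m010 (0, 1, 0) @ replicate m001 (0, 0, 1) @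
      replicate m110 (1, 1, 0) @ replicate m101 (1, 0, 1) @ replicate m011 (0, 1, 1) @
      replicate m111 (1, 1, 1)"
  define word where "word f = vec_of_list (map f cols)" for f :: "bit \<times> bit \<times> bit \<Rightarrow> bit"
  let ?a = "word fst" and ?b = "word (\<lambda>v. fst (snd v))" and ?c = "word (\<lambda>v. snd (snd v))"
  have carrier: "word f \<in> carrier_vec n" for f
    unfolding word_def carrier_vec_def by (simp add: cols_def n)
  have add: "word f + word g = word (\<lambda>v. f v + g v)" for f g
    unfolding word_def by (rule vec_of_list_add)
  have weight: "hamming_weight (word f) = length (filter (\<lambda>v. f v \<noteq> 0) cols)" for f
    unfolding word_def hamming_weight_vec_of_list by (simp add: filter_map o_def)
  have "weight_tuple ?a ?b ?c =
    (m100 + m110 + m101 + m111, m010 + m110 + m011 + m111, m001 + m101 + m011 + m111,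
     m010 + m001 + m110 + m101, m100 + m001 + m110 + m011, m100 + m010 + m101 + m011,
     m100 + m010 + m001 + m111)"
    unfolding weight_tuple_def add weight by (simp add: cols_def)
  then show ?thesis using carrier by blast
qed

text \<open>
  For weights \<open>d + x1\<close>, ..., \<open>d + z\<close>, the seven inequalities saying that the multiplicities of the
  nonzero columns are not negative. Four entries are compared with the other three, so one \<open>d\<close>
  remains.
\<close>

definition columns_nonneg :: "nat \<Rightarrow> weights7 \<Rightarrow> bool" where
  "columns_nonneg d = (\<lambda>(x1, x2, x3, y1, y2, y3, z).
     x2 + x3 + y1 \<le> d + x1 + y2 + y3 + z \<and> x1 + x3 + y2 \<le> d + x2 + y1 + y3 + z \<and>
     x1 + x2 + y3 \<le> d + x3 + y1 + y2 + z \<and> x3 + y3 + z \<le> d + x1 + x2 + y1 + y2 \<and>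
     x2 + y2 + z \<le> d + x1 + x3 + y1 + y3 \<and> x1 + y1 + z \<le> d + x2 + x3 + y2 + y3 \<and>
     y1 + y2 + y3 \<le> d + x1 + x2 + x3 + z)"

text \<open>
  The congruences make the column multiplicities computed from the weights integral, since each
  weight is an integer combination of \<open>x1\<close>, \<open>x2\<close>, \<open>x3\<close> plus a multiple of 4. The inequalities make
  them nonnegative, and the sum condition leaves no zero column.
\<close>

lemma exists_orthonormal_basis_with_weights:
  assumes "orthonormal_weights (x1, x2, x3, y1, y2, y3, z)"
    and "columns_nonneg 0 (x1, x2, x3, y1, y2, y3, z)"
    and "x1 + x2 + x3 + y1 + y2 + y3 + z = 4 * n"
  shows "\<exists>C a b c. orthonormal_basis n C a b c \<and> weight_tuple a b c = (x1, x2, x3, y1, y2, y3, z)"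
proof -
  have mod4: "\<exists>k. int y = int x + 4 * k" if "y mod 4 = x mod 4" for x y :: nat
  proof -
    have split: "int v = 4 * int (v div 4) + int (v mod 4)" for v :: nat
      by (metis mult_div_mod_eq of_nat_add of_nat_mult of_nat_numeral)
    have "int y = int x + 4 * (int (y div 4) - int (x div 4))"
      using split[of x] split[of y] that by simp
    then show ?thesis by blast
  qed
  obtain k1 where k1: "int y1 = int (x2 + x3) + 4 * k1"
    using mod4 assms(1) unfolding orthonormal_weights_def prod.case by blast
  obtain k2 where k2: "int y2 = int (x1 + x3) + 4 * k2"
    using mod4 assms(1) unfolding orthonormal_weights_def prod.case by blast
  obtain k3 where k3: "int y3 = int (x1 + x2) + 4 * k3"
    using mod4 assms(1) unfolding orthonormal_weights_def prod.case by blast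
  obtain k0 where k0: "int z = int (x1 + x2 + x3) + 4 * k0"
    using mod4 assms(1) unfolding orthonormal_weights_def prod.case by blast
  define m100 m010 m001 m110 m101 m011 m111
    where "m100 = nat (x1 + k0 + k2 + k3 - k1)" and "m010 = nat (x2 + k0 + k1 + k3 - k2)"
      and "m001 = nat (x3 + k0 + k1 + k2 - k3)" and "m110 = nat (k1 + k2 - k3 - k0)"
      and "m101 = nat (k1 + k3 - k2 - k0)" and "m011 = nat (k2 + k3 - k1 - k0)"
      and "m111 = nat (k0 - k1 - k2 - k3)"
  have ge: "x1 + k0 + k2 + k3 - k1 \<ge> 0" "x2 + k0 + k1 + k3 - k2 \<ge> 0" "x3 + k0 + k1 + k2 - k3 \<ge> 0"
    "k1 + k2 - k3 - k0 \<ge> 0" "k1 + k3 - k2 - k0 \<ge> 0" "k2 + k3 - k1 - k0 \<ge> 0" "k0 - k1 - k2 - k3 \<ge> 0"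
    using assms(2) k0 k1 k2 k3 unfolding columns_nonneg_def prod.case by linarith+
  then have m: "int m100 = x1 + k0 + k2 + k3 - k1" "int m010 = x2 + k0 + k1 + k3 - k2"
    "int m001 = x3 + k0 + k1 + k2 - k3" "int m110 = k1 + k2 - k3 - k0"
    "int m101 = k1 + k3 - k2 - k0" "int m011 = k2 + k3 - k1 - k0" "int m111 = k0 - k1 - k2 - k3"
    by (simp_all add: m100_def m010_def m001_def m110_def m101_def m011_def m111_def)
  have n: "n = m100 + m010 + m001 + m110 + m101 + m011 + m111"
    using assms(3) m k0 k1 k2 k3 by linarith
  have w: "m100 + m110 + m101 + m111 = x1" "m010 + m110 + m011 + m111 = x2"
    "m001 + m101 + m011 + m111 = x3" "m010 + m001 + m110 + m101 = y1"
    "m100 + m001 + m110 + m011 = y2" "m100 + m010 + m101 + m011 = y3"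
    "m100 + m010 + m001 + m111 = z"
    using m k0 k1 k2 k3 by linarith+
  obtain a b c where abc: "a \<in> carrier_vec n" "b \<in> carrier_vec n" "c \<in> carrier_vec n"
      "weight_tuple a b c = (x1, x2, x3, y1, y2, y3, z)"
    using exists_words_with_column_counts[OF n] unfolding w by blast
  then have "orthonormal_basis n (span3 n a b c) a b c"
    using orthonormal_basis_iff_weights[OF abc(1-3)] assms(1) by simp
  then show ?thesis using abc(4) by blast
qed

section \<open>Dual distance\<close>

lemma orthonormal_basis_coordinates:
  assumes "orthonormal_basis n C a b c"
  shows "\<exists>x\<in>C. x \<bullet> a = p \<and> x \<bullet> b = q \<and> x \<bullet> c = r"
proof -
  note dots = add_scalar_prod_distrib[of _ n] orthonormal_basisD(1-12)[OF assms]
  have "p = 0 \<or> p = 1" "q = 0 \<or> q = 1" "r = 0 \<or> r = 1" using bit_not_zero_iff by blast+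
  then show ?thesis
    unfolding orthonormal_basisD(13)[OF assms]
    by (elim disjE) (simp_all add: dots)
qed

text \<open>
  A unit vector minus its projection to the code lies in the dual. If the dual were zero, all \<open>n\<close>
  unit vectors would be nonzero codewords, of which there are only seven. Nonvanishing of the dual
  gives the dual distance its meaning as a minimum.
\<close>

lemma exists_nonzero_dual_word:
  assumes onb: "orthonormal_basis n C a b c" and "n \<ge> 8"
  shows "\<exists>u\<in>dual_code n C. u \<noteq> 0\<^sub>v n"
proof (rule ccontr)
  assume trivial: "\<not> ?thesis"
  note abc = orthonormal_basisD(1-3)[OF onb]
  have C: "additive n C" "card C = 8"
    using orthonormal_imp_LCD(1)[OF onb] by (simp_all add: binary_code_3_iff)
  have "unit_vec n i \<in> C - {0\<^sub>v n}" if "i < n" for i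
  proof -
    obtain x where x: "x \<in> C" "x \<bullet> a = unit_vec n i \<bullet> a" "x \<bullet> b = unit_vec n i \<bullet> b"
        "x \<bullet> c = unit_vec n i \<bullet> c"
      using orthonormal_basis_coordinates[OF onb] by metis
    have x': "x \<in> carrier_vec n" using x(1) C(1) by (auto simp: additive_def)
    have u: "unit_vec n i + x \<in> carrier_vec n" using x' by simp
    have "(unit_vec n i + x) \<bullet> y = 0" if "y \<in> C" for y
    proof (rule scalar_prod_span3_zero[OF abc u])
      show "(unit_vec n i + x) \<bullet> a = 0" "(unit_vec n i + x) \<bullet> b = 0" "(unit_vec n i + x) \<bullet> c = 0"
        using x' abc x(2-4) by (simp_all add: add_scalar_prod_distrib[of _ n])
      show "y \<in> span3 n a b c" using that onb by (simp add: orthonormal_basis_def)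
    qed
    then have "unit_vec n i + x = 0\<^sub>v n"
      using trivial u unfolding dual_code_def by blast
    then have "unit_vec n i = x"
      using bit_vec_add_eq_zero x' unit_vec_carrier by blast
    then show ?thesis using x(1) unit_vec_nonzero[OF that] by auto
  qed
  then have "unit_vec n ` {..<n} \<subseteq> C - {0\<^sub>v n}"
    by (intro image_subsetI) (simp only: lessThan_iff)
  moreover have "inj_on (unit_vec n :: nat \<Rightarrow> bit vec) {..<n}"
  proof (rule inj_onI)
    fix i j assume "i \<in> {..<n}" "j \<in> {..<n}" "unit_vec n i = (unit_vec n j :: bit vec)"
    then have "unit_vec n i $ i = (unit_vec n j $ i :: bit)" by simp
    then show "i = j" using \<open>i \<in> {..<n}\<close> \<open>j \<in> {..<n}\<close> by (simp split: if_splits)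
  qed
  moreover have "finite C" using C(2) card.infinite by force
  ultimately have "n \<le> card (C - {0\<^sub>v n})"
    using card_inj_on_le[of "unit_vec n" "{..<n}" "C - {0\<^sub>v n}"] by simp
  then show False using C \<open>finite C\<close> \<open>n \<ge> 8\<close> by (simp add: additive_def)
qed

text \<open>
  A dual word of weight 1 is a unit vector, and a unit vector lies in the dual exactly if the code
  vanishes at its coordinate.
\<close>

lemma dual_distance_ge_2_iff:
  assumes onb: "orthonormal_basis n C a b c" and "n \<ge> 8"
  shows "dual_distance n C \<ge> 2 \<longleftrightarrow> (\<forall>i<n. (a $ i, b $ i, c $ i) \<noteq> (0, 0, 0))"
proof -
  note abc = orthonormal_basisD(1-3)[OF onb] and C = orthonormal_basisD(13)[OF onb]
  have "dual_code n C \<subseteq> carrier_vec n" by (auto simp: dual_code_def)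
  then have "finite (dual_code n C)"
    using finite_binary_vectors finite_subset by blast
  then have "dual_distance n C \<ge> 2 \<longleftrightarrow> (\<forall>x\<in>dual_code n C - {0\<^sub>v n}. hamming_weight x \<ge> 2)"
    unfolding dual_distance_def min_weight_def
    using exists_nonzero_dual_word[OF assms] by (subst Min_ge_iff) auto
  also have "\<dots> \<longleftrightarrow> (\<forall>i<n. (a $ i, b $ i, c $ i) \<noteq> (0, 0, 0))"
  proof (intro iffI allI impI ballI notI)
    fix i assume dual: "\<forall>x\<in>dual_code n C - {0\<^sub>v n}. hamming_weight x \<ge> 2" and i: "i < n"
      and zero: "(a $ i, b $ i, c $ i) = (0, 0, 0)"
    have "unit_vec n i \<bullet> y = 0" if "y \<in> C" for y
    proof (rule scalar_prod_span3_zero[OF abc])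
      show "unit_vec n i \<bullet> a = 0" "unit_vec n i \<bullet> b = 0" "unit_vec n i \<bullet> c = 0"
        using zero i abc by simp_all
      show "y \<in> span3 n a b c" using that onb by (simp add: orthonormal_basis_def)
    qed simp
    then have "unit_vec n i \<in> dual_code n C - {0\<^sub>v n}"
      using unit_vec_nonzero[OF i] by (simp add: dual_code_def)
    then have "hamming_weight (unit_vec n i) \<ge> 2" using dual by blast
    moreover have "{j. j < dim_vec (unit_vec n i) \<and> unit_vec n i $ j \<noteq> (0 :: bit)} = {i}"
      using i by (auto split: if_splits)
    ultimately show False by (simp add: hamming_weight_def)
  next
    fix x assume cols: "\<forall>i<n. (a $ i, b $ i, c $ i) \<noteq> (0, 0, 0)" and x: "x \<in> dual_code n C - {0\<^sub>v n}"
    have x': "x \<in> carrier_vec n" using x by (simp add: dual_code_def)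
    let ?supp = "{i. i < dim_vec x \<and> x $ i \<noteq> 0}"
    have "?supp \<noteq> {}"
    proof
      assume "?supp = {}"
      then have "x = 0\<^sub>v n" using x' by (intro eq_vecI) auto
      then show False using x by blast
    qed
    moreover have "card ?supp \<noteq> 1"
    proof
      assume "card ?supp = 1"
      then obtain i where i: "?supp = {i}" using card_1_singletonE by blast
      then have "i \<in> ?supp" by blast
      then have "i < n" "x $ i = 1" using x' by auto
      moreover have "x $ j = 0" if "j < n" "j \<noteq> i" for j
      proof -
        have "j \<notin> ?supp" unfolding i using that by simp
        then show ?thesis using that x' by auto
      qed
      ultimately have "x = unit_vec n i"
        using x' by (intro eq_vecI) auto
      moreover have "x \<bullet> a = 0" "x \<bullet> b = 0" "x \<bullet> c = 0"
        using x C by (auto simp: dual_code_def)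
      ultimately have "(a $ i, b $ i, c $ i) = (0, 0, 0)"
        using abc \<open>i < n\<close> by simp
      then show False using cols \<open>i < n\<close> by blast
    qed
    moreover have "finite ?supp" by simp
    ultimately show "hamming_weight x \<ge> 2"
      unfolding hamming_weight_def using card_0_eq[of ?supp] by linarith
  qed
  finally show ?thesis .
qed

section \<open>Weights in excess of the minimum weight\<close>

fun entries :: "weights7 \<Rightarrow> nat list" where
  "entries (x1, x2, x3, y1, y2, y3, z) = [x1, x2, x3, y1, y2, y3, z]"

fun shift :: "nat \<Rightarrow> weights7 \<Rightarrow> weights7" where
  "shift d (x1, x2, x3, y1, y2, y3, z) = (d + x1, d + x2, d + x3, d + y1, d + y2, d + y3, d + z)"

fun tuple_profile :: "weights7 \<Rightarrow> (nat \<times> nat) multiset \<times> nat" where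
  "tuple_profile (x1, x2, x3, y1, y2, y3, z) = (mset [(x1, y1), (x2, y2), (x3, y3)], z)"

lemma profile_eq_tuple_profile: "profile a b c = tuple_profile (weight_tuple a b c)"
  by (simp add: profile_def weight_tuple_def)

lemma set_entries_weight_tuple:
  assumes onb: "orthonormal_basis n C a b c"
  shows "set (entries (weight_tuple a b c)) = hamming_weight ` (C - {0\<^sub>v n})"
proof -
  note dots = add_scalar_prod_distrib[of _ n] orthonormal_basisD(1-12)[OF onb]
    scalar_prod_left_zero[of _ n]
  have nonzero: "x \<noteq> 0\<^sub>v n" if "x \<bullet> a = 1 \<or> x \<bullet> b = 1 \<or> x \<bullet> c = 1" for x
    using that scalar_prod_left_zero orthonormal_basisD(1-3)[OF onb] zero_neq_one by metis
  have "0\<^sub>v n \<notin> {a, b, c, b + c, a + c, a + b, a + b + c}"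
    using nonzero[of a] nonzero[of b] nonzero[of c] nonzero[of "b + c"] nonzero[of "a + c"]
      nonzero[of "a + b"] nonzero[of "a + b + c"] by (auto simp add: dots(1-13))
  then have "C - {0\<^sub>v n} = {a, b, c, b + c, a + c, a + b, a + b + c}"
    unfolding orthonormal_basisD(13)[OF onb] by blast
  then show ?thesis by (simp add: weight_tuple_def)
qed

lemma min_weight_eq:
  assumes "orthonormal_basis n C a b c"
  shows "min_weight n C = d \<longleftrightarrow> d \<in> set (entries (weight_tuple a b c)) \<and>
    (\<forall>w\<in>set (entries (weight_tuple a b c)). d \<le> w)"
proof -
  have "set (entries (weight_tuple a b c)) \<noteq> {}"
    by (simp add: weight_tuple_def)
  then show ?thesis
    unfolding min_weight_def set_entries_weight_tuple[OF assms, symmetric]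
    by (intro Min_eq_iff) simp_all
qed

text \<open>
  All excesses of total \<open>E\<close> over a common bound \<open>d\<close> for which the weights satisfy the congruences of
  an orthonormal basis. The congruences involve \<open>d\<close> only through \<open>r = d mod 4\<close>, which makes the
  search finite for a whole family of lengths. Each congruence is tested as soon as its entries are
  chosen.
\<close>

definition excess_tuples :: "nat \<Rightarrow> nat \<Rightarrow> weights7 list" where
  "excess_tuples r E =
    [(x1, x2, x3, y1, y2, y3, z).
       x1 \<leftarrow> [0..<Suc E], odd (r + x1),
       x2 \<leftarrow> [0..<Suc (E - x1)], odd (r + x2),
       x3 \<leftarrow> [0..<Suc (E - (x1 + x2))], odd (r + x3),
       y1 \<leftarrow> [0..<Suc (E - (x1 + x2 + x3))], (r + y1) mod 4 = (r + x2 + (r + x3)) mod 4,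
       y2 \<leftarrow> [0..<Suc (E - (x1 + x2 + x3 + y1))], (r + y2) mod 4 = (r + x1 + (r + x3)) mod 4,
       y3 \<leftarrow> [0..<Suc (E - (x1 + x2 + x3 + y1 + y2))], (r + y3) mod 4 = (r + x1 + (r + x2)) mod 4,
       z \<leftarrow> [E - (x1 + x2 + x3 + y1 + y2 + y3)],
       x1 + x2 + x3 + y1 + y2 + y3 + z = E \<and> (r + z) mod 4 = (r + x1 + (r + x2) + (r + x3)) mod 4]"

text \<open>
  Bounding each entry by what is left of the total loses nothing. The tests are arbitrary here, so
  that the argument stays free of modular arithmetic.
\<close>

lemma mem_bounded_search:
  fixes E :: nat
  shows "(x1, x2, x3, y1, y2, y3, z) \<in> set
    [(x1, x2, x3, y1, y2, y3, z).
       x1 \<leftarrow> [0..<Suc E], p1 x1,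
       x2 \<leftarrow> [0..<Suc (E - x1)], p2 x1 x2,
       x3 \<leftarrow> [0..<Suc (E - (x1 + x2))], p3 x1 x2 x3,
       y1 \<leftarrow> [0..<Suc (E - (x1 + x2 + x3))], q1 x1 x2 x3 y1,
       y2 \<leftarrow> [0..<Suc (E - (x1 + x2 + x3 + y1))], q2 x1 x2 x3 y1 y2,
       y3 \<leftarrow> [0..<Suc (E - (x1 + x2 + x3 + y1 + y2))], q3 x1 x2 x3 y1 y2 y3,
       z \<leftarrow> [E - (x1 + x2 + x3 + y1 + y2 + y3)],
       x1 + x2 + x3 + y1 + y2 + y3 + z = E \<and> q x1 x2 x3 y1 y2 y3 z] \<longleftrightarrow>
    p1 x1 \<and> p2 x1 x2 \<and> p3 x1 x2 x3 \<and> q1 x1 x2 x3 y1 \<and> q2 x1 x2 x3 y1 y2 \<and>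
    q3 x1 x2 x3 y1 y2 y3 \<and> x1 + x2 + x3 + y1 + y2 + y3 + z = E \<and> q x1 x2 x3 y1 y2 y3 z"
  (is "?e \<in> set ?L \<longleftrightarrow> ?R")
proof -
  have step: "e \<in> set (concat (map (\<lambda>x. if P x then f x else []) xs)) \<longleftrightarrow>
      (\<exists>x\<in>set xs. P x \<and> e \<in> set (f x))" for e :: "'a" and P :: "nat \<Rightarrow> bool" and f xs
    by auto
  show ?thesis
    unfolding step
  proof (rule iffI, goal_cases)
    case 1
    then show ?case by (elim bexE conjE) simp
  next
    case 2
    then have E: "x1 + x2 + x3 + y1 + y2 + y3 + z = E" by blast
    have range: "x \<in> set [0..<Suc k] \<longleftrightarrow> x \<le> k" for x k
      by (simp only: set_upt atLeastLessThan_iff) linarith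
    have "x1 \<in> set [0..<Suc E]" "x2 \<in> set [0..<Suc (E - x1)]" "x3 \<in> set [0..<Suc (E - (x1 + x2))]"
      "y1 \<in> set [0..<Suc (E - (x1 + x2 + x3))]" "y2 \<in> set [0..<Suc (E - (x1 + x2 + x3 + y1))]"
      "y3 \<in> set [0..<Suc (E - (x1 + x2 + x3 + y1 + y2))]" "z \<in> set [E - (x1 + x2 + x3 + y1 + y2 + y3)]"
      unfolding range using E by simp_all
    moreover have "?e \<in> set [?e]" by simp
    ultimately show ?case using 2 by blast
  qed
qed

lemma mem_excess_tuples:
  "e \<in> set (excess_tuples (d mod 4) E) \<longleftrightarrow>
     orthonormal_weights (shift d e) \<and> sum_list (entries e) = E"
proof -
  obtain x1 x2 x3 y1 y2 y3 z where e: "e = (x1, x2, x3, y1, y2, y3, z)"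
    by (metis prod_cases7)
  have odd: "odd (d mod 4 + x) \<longleftrightarrow> odd (d + x)" for x
    by presburger
  have reduce: "(d mod 4 + x) mod 4 = (d + x) mod 4" for x
    by (simp add: mod_simps)
  have two: "(d mod 4 + x + (d mod 4 + x')) mod 4 = (d + x + (d + x')) mod 4" for x x'
    by (intro mod_add_cong reduce)
  have three: "(d mod 4 + x + (d mod 4 + x') + (d mod 4 + x'')) mod 4 =
      (d + x + (d + x') + (d + x'')) mod 4" for x x' x''
    by (intro mod_add_cong reduce)
  have total: "sum_list [x1, x2, x3, y1, y2, y3, z] = x1 + x2 + x3 + y1 + y2 + y3 + z"
    by simp
  show ?thesis
    unfolding e excess_tuples_def mem_bounded_search orthonormal_weights_def shift.simps entries.simps
      prod.case odd reduce two three total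
    by blast
qed

lemma weights_in_excess_tuples:
  assumes onb: "orthonormal_basis n C a b c"
    and ge: "\<forall>w\<in>set (entries (weight_tuple a b c)). d \<le> w"
    and sum: "sum_list (entries (weight_tuple a b c)) = 7 * d + E"
  shows "\<exists>e\<in>set (excess_tuples (d mod 4) E). weight_tuple a b c = shift d e"
proof -
  obtain x1 x2 x3 y1 y2 y3 z where w: "weight_tuple a b c = (x1, x2, x3, y1, y2, y3, z)"
    by (metis prod_cases7)
  define e where "e = (x1 - d, x2 - d, x3 - d, y1 - d, y2 - d, y3 - d, z - d)"
  have shift: "weight_tuple a b c = shift d e"
    using ge unfolding w e_def by simp
  moreover have "orthonormal_weights (weight_tuple a b c)"
    using onb orthonormal_basis_iff_weights[OF orthonormal_basisD(1-3)[OF onb]]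
    by (simp add: orthonormal_basis_def)
  moreover have "sum_list (entries e) = E"
    using sum ge unfolding w e_def by simp
  ultimately show ?thesis using mem_excess_tuples by metis
qed

lemma sum_weights_le:
  assumes "orthonormal_basis n C a b c"
  shows "sum_list (entries (weight_tuple a b c)) \<le> 4 * n"
  using sum_weights_eq[OF orthonormal_basisD(1-3)[OF assms]] by (simp add: weight_tuple_def)

text \<open>
  The weights sum up to four times the number of nonzero columns.
\<close>

lemma dual_distance_iff_sum_weights:
  assumes onb: "orthonormal_basis n C a b c" and "n \<ge> 8"
  shows "dual_distance n C \<ge> 2 \<longleftrightarrow> sum_list (entries (weight_tuple a b c)) = 4 * n"
proof -
  have "dual_distance n C \<ge> 2 \<longleftrightarrow> (0, 0, 0) \<notin> set (columns n a b c)"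
    unfolding dual_distance_ge_2_iff[OF assms] by (auto simp: columns_def)
  also have "\<dots> \<longleftrightarrow> count (mset (columns n a b c)) (0, 0, 0) = 0"
    by (simp add: count_eq_zero_iff)
  moreover have "sum_list (entries (weight_tuple a b c)) + 4 * count (mset (columns n a b c)) (0, 0, 0) = 4 * n"
    using sum_weights_eq[OF orthonormal_basisD(1-3)[OF onb]]
    by (simp add: weight_tuple_def add.assoc)
  then have "count (mset (columns n a b c)) (0, 0, 0) = 0 \<longleftrightarrow>
      sum_list (entries (weight_tuple a b c)) = 4 * n"
    by linarith
  ultimately show ?thesis by (simp only:)
qed

lemma binary_code_dist_iff:
  assumes onb: "orthonormal_basis n C a b c"
  shows "binary_code_dist n 3 d C \<longleftrightarrow> min_weight n C = d"
proof -
  have "C \<noteq> {0\<^sub>v n}"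
    using orthonormal_imp_LCD(1)[OF onb] by (auto simp: binary_code_3_iff)
  then show ?thesis
    using orthonormal_imp_LCD(1)[OF onb] by (simp add: binary_code_dist_def)
qed

section \<open>The optimal minimum weight\<close>

text \<open>
  A code of larger minimum weight would have all weights at least \<open>d + 1\<close>. Its excesses over
  \<open>d + 1\<close> would have total at most \<open>4 n - 7 (d + 1)\<close>, with equality only without zero columns.
\<close>

lemma d2_eqI:
  assumes onb: "orthonormal_basis n C a b c" and "min_weight n C = d"
    and none: "\<And>E. 7 * (d + 1) + E \<le> 4 * n \<Longrightarrow> excess_tuples ((d + 1) mod 4) E = []"
  shows "d2 n 3 = d"
proof -
  let ?D = "{d. \<exists>C. binary_code_dist n 3 d C \<and> LCD n C}"
  have le: "d' \<le> d" if d': "d' \<in> ?D" for d'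
  proof (rule ccontr)
    assume "\<not> d' \<le> d"
    obtain C' where C': "binary_code_dist n 3 d' C'" "LCD n C'" using d' by blast
    then obtain x y z where xyz: "orthonormal_basis n C' x y z"
      using LCD_imp_orthonormal unfolding binary_code_dist_def by blast
    let ?w = "weight_tuple x y z"
    have ge: "\<forall>w\<in>set (entries ?w). d + 1 \<le> w"
      using min_weight_eq[OF xyz, of d'] C'(1) \<open>\<not> d' \<le> d\<close> by (auto simp: binary_code_dist_def)
    then have "7 * (d + 1) \<le> sum_list (entries ?w)"
      by (simp add: weight_tuple_def)
    then obtain E where E: "sum_list (entries ?w) = 7 * (d + 1) + E"
      using le_Suc_ex by blast
    then have "excess_tuples ((d + 1) mod 4) E = []"
      using sum_weights_le[OF xyz] by (intro none) simp
    then show False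
      using weights_in_excess_tuples[OF xyz ge E] by simp
  qed
  moreover have "d \<in> ?D"
    using binary_code_dist_iff[OF onb, of d] orthonormal_imp_LCD(2)[OF onb] assms(2) by blast
  moreover have "finite ?D"
    using le finite_subset[of ?D "{..d}"] by blast
  ultimately show ?thesis
    unfolding d2_def by (intro Max_eqI) blast+
qed

section \<open>Counting equivalence classes\<close>

lemma card_quotient_eq_card_invariant:
  assumes R: "equiv A R" and S: "S \<subseteq> A"
    and inv: "\<And>x y. x \<in> S \<Longrightarrow> y \<in> S \<Longrightarrow> (x, y) \<in> R \<longleftrightarrow> f x = f y"
  shows "card (S // R) = card (f ` S)"
proof -
  have "bij_betw (\<lambda>v. R `` {inv_into S f v}) (f ` S) (S // R)"
  proof (rule bij_betwI')
    fix u v assume "u \<in> f ` S" "v \<in> f ` S"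
    then have "inv_into S f u \<in> S" "inv_into S f v \<in> S"
      and "f (inv_into S f u) = u" "f (inv_into S f v) = v"
      by (simp_all add: inv_into_into f_inv_into_f)
    then show "R `` {inv_into S f u} = R `` {inv_into S f v} \<longleftrightarrow> u = v"
      using inv eq_equiv_class_iff[OF R] S by (metis subsetD)
  next
    show "R `` {inv_into S f v} \<in> S // R" if "v \<in> f ` S" for v
      using inv_into_into[OF that] by (rule quotientI)
  next
    fix X assume "X \<in> S // R"
    then obtain x where x: "x \<in> S" "X = R `` {x}" by (rule quotientE)
    then have "inv_into S f (f x) \<in> S" "f (inv_into S f (f x)) = f x"
      by (simp_all add: inv_into_into f_inv_into_f)
    then have "(x, inv_into S f (f x)) \<in> R"
      using inv x(1) by simp
    then have "X = R `` {inv_into S f (f x)}"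
      unfolding x(2) by (rule equiv_class_eq[OF R])
    then show "\<exists>v\<in>f ` S. X = R `` {inv_into S f v}" using x(1) by blast
  qed
  then show ?thesis by (simp add: bij_betw_same_card)
qed

text \<open>
  Well defined on LCD codes of dimension three by uniqueness of the orthonormal basis up to order.
\<close>

definition code_profile :: "nat \<Rightarrow> bit vec set \<Rightarrow> (nat \<times> nat) multiset \<times> nat" where
  "code_profile n C = (THE P. \<exists>a b c. orthonormal_basis n C a b c \<and> P = profile a b c)"

lemma code_profile_eq:
  assumes "orthonormal_basis n C a b c"
  shows "code_profile n C = profile a b c"
  unfolding code_profile_def using assms profile_unique by (intro the_equality) blast+

lemma tuple_profile_shift:
  "tuple_profile (shift d e) =
    map_prod (image_mset (map_prod ((+) d) ((+) d))) ((+) d) (tuple_profile e)"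
  by (cases e) simp

lemma card_tuple_profile_shift:
  "card ((\<lambda>e. tuple_profile (shift d e)) ` T) = card (tuple_profile ` T)"
proof -
  let ?s = "map_prod (image_mset (map_prod ((+) d) ((+) d))) ((+) d)"
  have "inj ?s"
    by (intro prod.inj_map multiset.inj_map inj_on_add)
  moreover have "(\<lambda>e. tuple_profile (shift d e)) ` T = ?s ` tuple_profile ` T"
    by (simp add: tuple_profile_shift image_image)
  ultimately show ?thesis
    by (metis card_image inj_on_subset subset_UNIV)
qed

text \<open>
  The profile identifies equivalence classes with profiles of excess tuples. The minimum weight is
  attained exactly if some excess is zero, and by nonnegativity of the column multiplicities every
  such tuple comes from a code; a single one shows that \<open>d\<close> is a minimum weight. The shift by \<open>d\<close>
  is injective on profiles, so the count depends on \<open>d mod 4\<close> and \<open>E\<close> only.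
\<close>

lemma card_optimal_classes:
  assumes n: "n \<ge> 8" "4 * n = 7 * d + E"
    and realizable: "\<forall>e\<in>set (excess_tuples (d mod 4) E). 0 \<in> set (entries e) \<longrightarrow> columns_nonneg d e"
    and exists: "\<exists>e\<in>set (excess_tuples (d mod 4) E). 0 \<in> set (entries e)"
    and none: "\<And>E. 7 * (d + 1) + E \<le> 4 * n \<Longrightarrow> excess_tuples ((d + 1) mod 4) E = []"
  shows "card ({C. optimal_LCD n 3 C \<and> dual_distance n C \<ge> 2} // code_equiv n 3) =
    card (tuple_profile ` {e \<in> set (excess_tuples (d mod 4) E). 0 \<in> set (entries e)})"
proof -
  let ?S = "{C. optimal_LCD n 3 C \<and> dual_distance n C \<ge> 2}"
  let ?T = "{e \<in> set (excess_tuples (d mod 4) E). 0 \<in> set (entries e)}"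
  have min: "min_weight n C = d \<longleftrightarrow> 0 \<in> set (entries e)"
    if "orthonormal_basis n C a b c" "weight_tuple a b c = shift d e" for C a b c e
    unfolding min_weight_eq[OF that(1)] that(2) by (cases e) auto
  have realize: "\<exists>C a b c. orthonormal_basis n C a b c \<and> weight_tuple a b c = shift d e"
    if e: "e \<in> ?T" for e
  proof -
    obtain x1 x2 x3 y1 y2 y3 z where e_eq: "e = (x1, x2, x3, y1, y2, y3, z)"
      by (metis prod_cases7)
    have "orthonormal_weights (shift d e)" "sum_list (entries e) = E" "columns_nonneg d e"
      using e mem_excess_tuples realizable by blast+
    moreover have "columns_nonneg 0 (shift d e)"
      using \<open>columns_nonneg d e\<close> unfolding e_eq shift.simps columns_nonneg_def prod.case
      by (elim conjE, intro conjI; linarith)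
    moreover have "d + x1 + (d + x2) + (d + x3) + (d + y1) + (d + y2) + (d + y3) + (d + z) = 4 * n"
      using n(2) \<open>sum_list (entries e) = E\<close> by (simp add: e_eq)
    ultimately show ?thesis
      unfolding e_eq shift.simps by (intro exists_orthonormal_basis_with_weights)
  qed
  have d2: "d2 n 3 = d"
  proof -
    obtain e where e: "e \<in> ?T" using exists by blast
    obtain C a b c where "orthonormal_basis n C a b c" "weight_tuple a b c = shift d e"
      using realize[OF e] by blast
    then show ?thesis using min e none by (intro d2_eqI) blast+
  qed
  have onb: "\<exists>a b c e. orthonormal_basis n C a b c \<and> weight_tuple a b c = shift d e \<and> e \<in> ?T"
    if C: "C \<in> ?S" for C
  proof -
    have dist: "binary_code_dist n 3 d C" "LCD n C" "dual_distance n C \<ge> 2"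
      using C d2 by (simp_all add: optimal_LCD_def)
    then obtain a b c where abc: "orthonormal_basis n C a b c"
      using LCD_imp_orthonormal unfolding binary_code_dist_def by blast
    have "\<forall>w\<in>set (entries (weight_tuple a b c)). d \<le> w"
      using dist(1) min_weight_eq[OF abc] binary_code_dist_iff[OF abc] by blast
    moreover have "sum_list (entries (weight_tuple a b c)) = 7 * d + E"
      using dist(3) dual_distance_iff_sum_weights[OF abc n(1)] n(2) by simp
    ultimately obtain e where e: "e \<in> set (excess_tuples (d mod 4) E)" "weight_tuple a b c = shift d e"
      using weights_in_excess_tuples[OF abc] by blast
    moreover have "0 \<in> set (entries e)"
      using min[OF abc e(2)] dist(1) binary_code_dist_iff[OF abc] by blast
    ultimately show ?thesis using abc by blast
  qed
  have "card (?S // code_equiv n 3) = card (code_profile n ` ?S)"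
  proof (rule card_quotient_eq_card_invariant[OF equiv_code_equiv])
    show "?S \<subseteq> {C. binary_code n 3 C}"
      using onb orthonormal_imp_LCD(1) by blast
    show "(C, D) \<in> code_equiv n 3 \<longleftrightarrow> code_profile n C = code_profile n D"
      if "C \<in> ?S" "D \<in> ?S" for C D
      using onb[OF that(1)] onb[OF that(2)] code_equiv_iff_profile code_profile_eq by metis
  qed
  also have "code_profile n ` ?S = (\<lambda>e. tuple_profile (shift d e)) ` ?T"
  proof (intro equalityI subsetI)
    fix P assume "P \<in> code_profile n ` ?S"
    then obtain C where C: "C \<in> ?S" "P = code_profile n C" by blast
    obtain a b c e where "orthonormal_basis n C a b c" "weight_tuple a b c = shift d e" "e \<in> ?T"
      using onb[OF C(1)] by blast
    then show "P \<in> (\<lambda>e. tuple_profile (shift d e)) ` ?T"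
      using C(2) code_profile_eq profile_eq_tuple_profile by (intro image_eqI[of _ _ e]) simp_all
  next
    fix P assume "P \<in> (\<lambda>e. tuple_profile (shift d e)) ` ?T"
    then obtain e where e: "e \<in> ?T" "P = tuple_profile (shift d e)" by blast
    obtain C a b c where abc: "orthonormal_basis n C a b c" "weight_tuple a b c = shift d e"
      using realize[OF e(1)] by blast
    have "sum_list (entries (shift d e)) = 4 * n"
      using e(1) mem_excess_tuples[of e d E] n(2) by (cases e) simp
    then have "dual_distance n C \<ge> 2"
      using dual_distance_iff_sum_weights[OF abc(1) n(1)] abc(2) by simp
    moreover have "optimal_LCD n 3 C"
      using min[OF abc] e(1) binary_code_dist_iff[OF abc(1)] orthonormal_imp_LCD(2)[OF abc(1)] d2
      by (simp add: optimal_LCD_def)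
    moreover have "P = code_profile n C"
      using e(2) abc code_profile_eq profile_eq_tuple_profile by simp
    ultimately show "P \<in> code_profile n ` ?S" by blast
  qed
  finally show ?thesis by (simp only: card_tuple_profile_shift)
qed

section \<open>The three families of lengths\<close>

lemma columns_nonneg_mono:
  assumes "columns_nonneg d e" "d \<le> d'"
  shows "columns_nonneg d' e"
  using assms unfolding columns_nonneg_def by (auto split: prod.splits)

definition attaining_excess_tuples :: "nat \<Rightarrow> nat \<Rightarrow> weights7 list" where
  "attaining_excess_tuples r E = filter (\<lambda>e. 0 \<in> set (entries e)) (excess_tuples r E)"

text \<open>
  One excess tuple for each class of length \<open>7 s + 1\<close>, where \<open>d = 4 s - 1\<close> and the excesses have
  total \<open>4 n - 7 d = 11\<close>. The fourth and the sixth have the same weight distribution, so the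
  weight distribution alone would not separate the classes.
\<close>

definition representatives_1 :: "weights7 list" where
  "representatives_1 =
    [(0, 0, 0, 3, 3, 3, 2), (0, 0, 2, 1, 1, 7, 0), (0, 0, 2, 1, 5, 3, 0), (0, 0, 2, 1, 1, 3, 4),
     (0, 2, 2, 3, 1, 1, 2), (0, 2, 4, 1, 3, 1, 0), (0, 0, 6, 1, 1, 3, 0)]"

text \<open>
  Length \<open>7 s + 4\<close>, where \<open>d = 4 s + 1\<close> and the total excess is 9.
\<close>

definition representatives_4 :: "weights7 list" where
  "representatives_4 =
    [(0, 0, 0, 1, 1, 5, 2), (0, 0, 0, 1, 1, 1, 6), (0, 0, 2, 3, 3, 1, 0), (0, 0, 4, 1, 1, 1, 2),
     (2, 2, 2, 1, 1, 1, 0)]"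

text \<open>
  Length \<open>7 s + 6\<close>, where \<open>d = 4 s + 2\<close> and the total excess is 10.
\<close>

definition representatives_6 :: "weights7 list" where
  "representatives_6 =
    [(1, 1, 1, 0, 0, 4, 3), (1, 1, 1, 0, 0, 0, 7), (1, 1, 3, 2, 2, 0, 1), (1, 1, 5, 0, 0, 0, 3),
     (3, 3, 3, 0, 0, 0, 1)]"

text \<open>
  The outcome of the exhaustive searches; the arguments are \<open>d mod 4\<close> and the total excess.
\<close>

lemma representatives_profiles:
  "set (map tuple_profile (attaining_excess_tuples 3 11)) = set (map tuple_profile representatives_1)"
  "set (map tuple_profile (attaining_excess_tuples 1 9)) = set (map tuple_profile representatives_4)"
  "set (map tuple_profile (attaining_excess_tuples 2 10)) = set (map tuple_profile representatives_6)"
  by code_simp+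

lemma distinct_representatives:
  "distinct (map tuple_profile representatives_1)"
  "distinct (map tuple_profile representatives_4)"
  "distinct (map tuple_profile representatives_6)"
  by code_simp+

text \<open>
  The bounds 7, 5 and 6 are the values of \<open>d\<close> for the smallest lengths 15, 11 and 13.
\<close>

lemma attaining_columns_nonneg:
  "list_all (columns_nonneg 7) (attaining_excess_tuples 3 11)"
  "list_all (columns_nonneg 5) (attaining_excess_tuples 1 9)"
  "list_all (columns_nonneg 6) (attaining_excess_tuples 2 10)"
  by code_simp+

text \<open>
  For minimum weight \<open>d + 1\<close> the total excess would be at most 4, 2 and 3 respectively, which is too
  small for the congruences.
\<close>

lemma no_better_excess_tuples:
  "list_all (\<lambda>E. excess_tuples 0 E = []) [0..<5]"
  "list_all (\<lambda>E. excess_tuples 2 E = []) [0..<3]"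
  "list_all (\<lambda>E. excess_tuples 3 E = []) [0..<4]"
  by code_simp+

text \<open>
  The finite data verified at the smallest length serve all lengths of a family, because the
  nonnegativity conditions get weaker as \<open>d\<close> grows.
\<close>

lemma card_optimal_classes_eq_length:
  assumes n: "n \<ge> 8" "4 * n = 7 * d + E" and r: "d mod 4 = r" "(d + 1) mod 4 = r'"
    and realizable: "list_all (columns_nonneg d0) (attaining_excess_tuples r E)" "d0 \<le> d"
    and none: "list_all (\<lambda>E. excess_tuples r' E = []) [0..<m]" "4 * n < 7 * (d + 1) + m"
    and profiles: "set (map tuple_profile (attaining_excess_tuples r E)) = set (map tuple_profile L)"
      "distinct (map tuple_profile L)" "L \<noteq> []"
  shows "card ({C. optimal_LCD n 3 C \<and> dual_distance n C \<ge> 2} // code_equiv n 3) = length L"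
proof -
  have attain: "{e \<in> set (excess_tuples (d mod 4) E). 0 \<in> set (entries e)} =
      set (attaining_excess_tuples r E)"
    by (auto simp: attaining_excess_tuples_def r)
  have "card ({C. optimal_LCD n 3 C \<and> dual_distance n C \<ge> 2} // code_equiv n 3) =
      card (tuple_profile ` set (attaining_excess_tuples r E))"
    unfolding attain[symmetric]
  proof (rule card_optimal_classes[OF n])
    show "\<forall>e\<in>set (excess_tuples (d mod 4) E). 0 \<in> set (entries e) \<longrightarrow> columns_nonneg d e"
      using realizable attain columns_nonneg_mono unfolding list_all_iff by blast
    have "attaining_excess_tuples r E \<noteq> []"
      using profiles(1,3) by auto
    then show "\<exists>e\<in>set (excess_tuples (d mod 4) E). 0 \<in> set (entries e)"
      using attain by (metis (mono_tags, lifting) empty_Collect_eq set_empty)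
    show "excess_tuples ((d + 1) mod 4) E' = []" if "7 * (d + 1) + E' \<le> 4 * n" for E'
      using none that unfolding r by (simp add: list_all_iff)
  qed
  also have "tuple_profile ` set (attaining_excess_tuples r E) = set (map tuple_profile L)"
    using profiles(1) by simp
  also have "card \<dots> = length L"
    using distinct_card[OF profiles(2)] by simp
  finally show ?thesis .
qed

theorem proposition6p2:
  shows "(\<forall>s::nat. s \<ge> 2 \<longrightarrow>
            card ({C. optimal_LCD (7 * s + 1) 3 C \<and> dual_distance (7 * s + 1) C \<ge> 2}
                  // code_equiv (7 * s + 1) 3) = 7) \<and>
         (\<forall>t::nat. t \<in> {4, 6} \<longrightarrow> (\<forall>s::nat. s \<ge> 1 \<longrightarrow>
            card ({C. optimal_LCD (7 * s + t) 3 C \<and> dual_distance (7 * s + t) C \<ge> 2}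
                  // code_equiv (7 * s + t) 3) = 5))"
proof (intro conjI allI impI)
  fix s :: nat assume s: "s \<ge> 2"
  \<comment> \<open>With \<open>s = k + 1\<close> the truncated difference \<open>4 * s - 1\<close> becomes \<open>4 * k + 3\<close>.\<close>
  then obtain k where k: "s = Suc k" by (cases s) auto
  show "card ({C. optimal_LCD (7 * s + 1) 3 C \<and> dual_distance (7 * s + 1) C \<ge> 2}
      // code_equiv (7 * s + 1) 3) = 7"
    by (subst card_optimal_classes_eq_length[where d = "4 * s - 1", OF _ _ _ _
          attaining_columns_nonneg(1) _ no_better_excess_tuples(1) _
          representatives_profiles(1) distinct_representatives(1)])
      (use s k in \<open>simp_all add: representatives_1_def\<close>)
next
  fix s t :: nat assume t: "t \<in> {4, 6}" and s: "s \<ge> 1"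
  have residues: "(4 * s + 1 + 1) mod 4 = 2" "(4 * s + 2) mod 4 = 2" by presburger+
  have "card ({C. optimal_LCD (7 * s + 4) 3 C \<and> dual_distance (7 * s + 4) C \<ge> 2}
      // code_equiv (7 * s + 4) 3) = 5"
    by (subst card_optimal_classes_eq_length[where d = "4 * s + 1", OF _ _ _ residues(1)
          attaining_columns_nonneg(2) _ no_better_excess_tuples(2) _
          representatives_profiles(2) distinct_representatives(2)])
      (use s in \<open>simp_all add: representatives_4_def\<close>)
  moreover have "card ({C. optimal_LCD (7 * s + 6) 3 C \<and> dual_distance (7 * s + 6) C \<ge> 2}
      // code_equiv (7 * s + 6) 3) = 5"
    by (subst card_optimal_classes_eq_length[where d = "4 * s + 2", OF _ _ residues(2) _
          attaining_columns_nonneg(3) _ no_better_excess_tuples(3) _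
          representatives_profiles(3) distinct_representatives(3)])
      (use s in \<open>simp_all add: representatives_6_def\<close>)
  ultimately show "card ({C. optimal_LCD (7 * s + t) 3 C \<and> dual_distance (7 * s + t) C \<ge> 2}
      // code_equiv (7 * s + t) 3) = 5"
    using t by blast
qed

end
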